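(* Let $p\ge 3$ and let $X\sim N_p(\theta,I_p)$ with unknown mean $\theta\in\mathbb{R}^p$. For $a\ge 0$ and $b>0$ consider the improper prior $\nu_{a,b}(d\theta)=(a+\|\theta\|^2)^{-b}\,d\theta$ on $\mathbb{R}^p$ (with $d\theta$ Lebesgue measure). Suppose either (A) $a>0$ and $b\in[p/2-1,p/2]$, or (B) $a=0$ and $b\in[p/2-1,p/2)$. Then $\nu_{a,b}$ (equivalently, its formal posterior $Q_{a,b}(d\theta\mid x)$) is strongly admissible.
   Context: For a statistical model $\{P(\cdot\mid\theta):\theta\in\Theta\}$ on a sample space $\mathcal{X}$ and a $\sigma$-finite measure $\nu$ on $\Theta$, the marginal measure is $M(B)=\int_\Theta P(B\mid\theta)\,\nu(d\theta)$. When $M$ is $\sigma$-finite, the formal posterior is a Markov kernel $Q(d\theta\mid x)$ with $P(dx\mid\theta)\nu(d\theta)=Q(d\theta\mid x)M(dx)$ as joint measures on $\mathcal{X}\times\Theta$. (For $\nu_{a,b}$ under (A) or (B), $M$ is $\sigma$-finite.) For a bounded measurable $\phi:\Theta\to\mathbb{R}$, loss $L(a,\theta)=(a-\phi(\theta))^2$, and an estimator $t$, the risk is $r(t,\theta)=\int (t(x)-\phi(\theta))^2P(dx\mid\theta)$. An estimator $t_0$ is almost-$\nu$-admissible if for every estimator $t$ with $r(t,\theta)\le r(t_0,\theta)$ for all $\theta$, the set $\{\theta: r(t,\theta)<r(t_0,\theta)\}$ has $\nu$-measure zero. The prior $\nu$ (equivalently $Q$) is strongly admissible if for every bounded measurable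 $\phi$ the formal Bayes estimator $\hat\phi(x)=\int\phi(\theta)Q(d\theta\mid x)$ is almost-$\nu$-admissible. *)

theory Defs
  imports "HOL-Probability.Probability"
begin

definition gauss_model :: "'a::euclidean_space \<Rightarrow> 'a measure" where
  "gauss_model \<theta> = density lborel
     (\<lambda>x. ennreal ((2 * pi) powr (- real DIM('a) / 2) * exp (- (norm (x - \<theta>))\<^sup>2 / 2)))"

definition improper_prior :: "real \<Rightarrow> real \<Rightarrow> 'a::euclidean_space measure" where
  "improper_prior a b = density lborel (\<lambda>\<theta>. ennreal ((a + (norm \<theta>)\<^sup>2) powr (- b)))"

definition marginal :: "'x measure \<Rightarrow> ('t \<Rightarrow> 'x measure) \<Rightarrow> 't measure \<Rightarrow> 'x measure" where
  "marginal SX P \<nu> = measure_of (space SX) (sets SX) (\<lambda>B. \<integral>\<^sup>+ \<theta>. emeasure (P \<theta>) B \<partial>\<nu>)"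

definition formal_posterior ::
  "'x measure \<Rightarrow> ('t \<Rightarrow> 'x measure) \<Rightarrow> 't measure \<Rightarrow> ('x \<Rightarrow> 't measure) \<Rightarrow> bool" where
  "formal_posterior SX P \<nu> Q \<longleftrightarrow>
     Q \<in> SX \<rightarrow>\<^sub>M prob_algebra \<nu> \<and>
     (\<forall>A \<in> sets (SX \<Otimes>\<^sub>M \<nu>).
        (\<integral>\<^sup>+ \<theta>. (\<integral>\<^sup>+ x. indicator A (x, \<theta>) \<partial>P \<theta>) \<partial>\<nu>) =
        (\<integral>\<^sup>+ x. (\<integral>\<^sup>+ \<theta>. indicator A (x, \<theta>) \<partial>Q x) \<partial>marginal SX P \<nu>))"

definition risk :: "('t \<Rightarrow> 'x measure) \<Rightarrow> ('t \<Rightarrow> real) \<Rightarrow> ('x \<Rightarrow> real) \<Rightarrow> 't \<Rightarrow> ennreal" where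
  "risk P \<phi> t \<theta> = (\<integral>\<^sup>+ x. ennreal ((t x - \<phi> \<theta>)\<^sup>2) \<partial>P \<theta>)"

definition almost_admissible ::
  "'x measure \<Rightarrow> ('t \<Rightarrow> 'x measure) \<Rightarrow> 't measure \<Rightarrow> ('t \<Rightarrow> real) \<Rightarrow> ('x \<Rightarrow> real) \<Rightarrow> bool" where
  "almost_admissible SX P \<nu> \<phi> t0 \<longleftrightarrow>
     (\<forall>t \<in> borel_measurable SX.
        (\<forall>\<theta> \<in> space \<nu>. risk P \<phi> t \<theta> \<le> risk P \<phi> t0 \<theta>) \<longrightarrow>
        (\<exists>N \<in> null_sets \<nu>. {\<theta> \<in> space \<nu>. risk P \<phi> t \<theta> < risk P \<phi> t0 \<theta>} \<subseteq> N))"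

definition strongly_admissible :: "'x measure \<Rightarrow> ('t \<Rightarrow> 'x measure) \<Rightarrow> 't measure \<Rightarrow> bool" where
  "strongly_admissible SX P \<nu> \<longleftrightarrow>
     (\<exists>Q. formal_posterior SX P \<nu> Q) \<and>
     (\<forall>Q. formal_posterior SX P \<nu> Q \<longrightarrow>
        (\<forall>\<phi> \<in> borel_measurable \<nu>. bounded (\<phi> ` space \<nu>) \<longrightarrow>
           almost_admissible SX P \<nu> \<phi> (\<lambda>x. \<integral>\<theta>. \<phi> \<theta> \<partial>Q x)))"

end

theory Submission
  imports Defs
begin

text \<open>
  Blyth's method with nonlocal test functions. If \<open>t\<close> dominates the formal Bayes estimator
  \<open>t\<^sub>0\<close> of a function bounded by \<open>K\<close>, then perturbing the prior by a factor \<open>u\<^sup>2\<close> shows that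
  \<open>\<integral> u\<^sup>2 (r(t\<^sub>0) - r(t)) d\<nu>\<close> is at most \<open>16 K\<^sup>2\<close> times the integral over \<open>x\<close> of the posterior variance
  of \<open>u\<close>. A variance only grows when the mean is replaced by another centre; the centre \<open>u(x)\<close>
  turns this integral into \<open>\<integral> E(u(\<theta> + Z) - u(\<theta>))\<^sup>2 \<nu>(d\<theta>)\<close> with \<open>Z\<close> standard normal, from which the
  posterior has disappeared. For \<open>b \<ge> p/2 - 1\<close> the prior decays at least like
  \<open>norm \<theta> powr (2 - p)\<close>, as if the dimension were two, and this energy is \<open>O(e)\<close> for the slowly
  decaying functions \<open>(1 + norm \<theta>) powr (- e)\<close>. Subtracting a constant and taking the positive
  part makes them compactly supported without increasing the energy.
\<close>

subsection \<open>Radial integrals of powers\<close>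

lemma nn_integral_powr_atLeast:
  fixes c e :: real assumes "c > 0" "e < -1"
  shows "(\<integral>\<^sup>+s. ennreal (s powr e) * indicator {c..} s \<partial>lborel) = ennreal (- (c powr (e + 1)) / (e + 1))"
  using nn_integral_has_integral_lebesgue'[OF _ has_integral_powr_to_inf[of e c]] assms
  by simp

text \<open>Layer cake: \<open>norm \<theta> powr (-q)\<close> is the integral of
  \<open>q * s powr (-q - 1)\<close> over \<open>s \<ge> norm \<theta>\<close>, and Tonelli moves
  the integral over \<theta> inside. Volumes of balls thus take the place of polar
  coordinates.\<close>

lemma nn_integral_norm_powr_layers:
  fixes q :: real and S :: "'a::euclidean_space set"
  assumes q: "q > 0" and S[measurable]: "S \<in> sets borel"
  shows "(\<integral>\<^sup>+\<theta>. ennreal (norm \<theta> powr (-q)) * indicator S \<theta> \<partial>lborel) =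
    (\<integral>\<^sup>+s. ennreal (q * s powr (-q - 1)) * indicator {0<..} s * emeasure lborel (S \<inter> cball 0 s) \<partial>lborel)"
proof -
  have inner: "(\<integral>\<^sup>+s. ennreal (q * s powr (-q - 1)) * indicator {0<..} s * indicator (S \<inter> cball 0 s) \<theta> \<partial>lborel)
     = ennreal (norm \<theta> powr (-q)) * indicator S \<theta>" if "\<theta> \<noteq> 0" for \<theta> :: 'a
  proof -
    from that have n: "norm \<theta> > 0" by simp
    have pos: "\<And>s. norm \<theta> \<le> s \<Longrightarrow> 0 < s" using n by linarith
    have "(\<integral>\<^sup>+s. ennreal (q * s powr (-q - 1)) * indicator {0<..} s * indicator (S \<inter> cball 0 s) \<theta> \<partial>lborel)
      = (\<integral>\<^sup>+s. (ennreal q * indicator S \<theta>) * (ennreal (s powr (-q - 1)) * indicator {norm \<theta>..} s) \<partial>lborel)"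
      using q by (intro nn_integral_cong) (auto simp: indicator_def ennreal_mult dest: pos)
    also have "\<dots> = ennreal q * indicator S \<theta> * ennreal (norm \<theta> powr (-q) / q)"
      using nn_integral_powr_atLeast[OF n, of "-q-1"] q by (subst nn_integral_cmult) auto
    also have "\<dots> = ennreal (norm \<theta> powr (-q)) * indicator S \<theta>"
      using q by (auto simp: indicator_def ennreal_mult[symmetric])
    finally show ?thesis .
  qed
  have "(\<integral>\<^sup>+\<theta>. ennreal (norm \<theta> powr (-q)) * indicator S \<theta> \<partial>lborel) =
    (\<integral>\<^sup>+\<theta>. (\<integral>\<^sup>+s. ennreal (q * s powr (-q - 1)) * indicator {0<..} s * indicator (S \<inter> cball 0 s) \<theta> \<partial>lborel) \<partial>(lborel :: 'a measure))"
    \<comment> \<open>The origin is left out: there \<open>0 powr (-q)\<close> is 0 while the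
      integral over \<open>s\<close> diverges.\<close>
    by (rule nn_integral_cong_AE, rule eventually_mono[OF AE_lborel_singleton[of 0]], rule inner[symmetric])
  also have "\<dots> = (\<integral>\<^sup>+s. (\<integral>\<^sup>+\<theta>. ennreal (q * s powr (-q - 1)) * indicator {0<..} s * indicator (S \<inter> cball 0 s) \<theta> \<partial>(lborel :: 'a measure)) \<partial>lborel)"
  proof (rule lborel_pair.Fubini')
    \<comment> \<open>Joint measurability is read off after membership in the ball is rewritten as
      \<open>0 \<le> s - norm \<theta>\<close>.\<close>
    have "(\<lambda>(s, \<theta>). ennreal (q * s powr (-q - 1)) * indicator {0<..} s * (indicator S \<theta> * indicator {x. 0 \<le> x} (s - norm \<theta>)))
       \<in> borel_measurable (lborel \<Otimes>\<^sub>M (lborel :: 'a measure))" by measurable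
    also have "(\<lambda>(s, \<theta>). ennreal (q * s powr (-q - 1)) * indicator {0<..} s * (indicator S \<theta> * indicator {x. 0 \<le> x} (s - norm \<theta>)))
       = (\<lambda>(s, \<theta>). ennreal (q * s powr (-q - 1)) * indicator {0<..} s * indicator (S \<inter> cball 0 s) \<theta>)"
      by (auto simp: fun_eq_iff indicator_def)
    finally show "\<dots> \<in> borel_measurable (lborel \<Otimes>\<^sub>M (lborel :: 'a measure))" .
  qed
  also have "\<dots> = (\<integral>\<^sup>+s. ennreal (q * s powr (-q - 1)) * indicator {0<..} s * emeasure lborel (S \<inter> cball 0 s) \<partial>lborel)"
    by (subst nn_integral_cmult) (auto intro!: borel_measurable_indicator)
  finally show ?thesis .
qed

text \<open>The layer at \<open>s\<close> is empty below \<open>s = 1\<close> and has at most the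
  volume of the ball of radius \<open>s\<close>. The pole in \<open>q - DIM('a)\<close> is kept
  explicit because it becomes \<open>1 / (2 * e)\<close> when
  \<open>q = DIM('a) + 2 * e\<close>.\<close>

lemma nn_integral_norm_powr_outside:
  fixes q :: real assumes q: "q > DIM('a::euclidean_space)"
  shows "(\<integral>\<^sup>+\<theta>. ennreal (norm \<theta> powr (-q)) * indicator (- ball 0 1) \<theta> \<partial>(lborel :: 'a measure))
    \<le> ennreal (q * unit_ball_vol DIM('a) / (q - DIM('a)))"
proof -
  let ?p = "real DIM('a)" and ?V = "unit_ball_vol DIM('a)"
  have q0: "q > 0" using q by simp
  have "(\<integral>\<^sup>+\<theta>. ennreal (norm \<theta> powr (-q)) * indicator (- ball 0 1) \<theta> \<partial>(lborel :: 'a measure))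
     \<le> (\<integral>\<^sup>+s. ennreal (q * ?V) * (ennreal (s powr (?p - q - 1)) * indicator {1..} s) \<partial>lborel)"
  proof (subst nn_integral_norm_powr_layers[OF q0], simp, rule nn_integral_mono)
    fix s :: real
    show "ennreal (q * s powr (-q - 1)) * indicator {0<..} s * emeasure lborel (- ball 0 1 \<inter> cball 0 s :: 'a set)
      \<le> ennreal (q * ?V) * (ennreal (s powr (?p - q - 1)) * indicator {1..} s)"
    proof (cases "s \<ge> 1")
      case True
      have "emeasure lborel (- ball 0 1 \<inter> cball 0 s :: 'a set) \<le> emeasure lborel (cball 0 s :: 'a set)"
        by (intro emeasure_mono) auto
      also have "\<dots> = ennreal (?V * s powr ?p)"
        using True by (simp add: emeasure_cball powr_realpow)
      finally have "ennreal (q * s powr (-q - 1)) * emeasure lborel (- ball 0 1 \<inter> cball 0 s :: 'a set)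
         \<le> ennreal (q * s powr (-q - 1)) * ennreal (?V * s powr ?p)" by (intro mult_left_mono) auto
      also have "\<dots> = ennreal (q * ?V) * ennreal (s powr (?p - q - 1))"
        using q0 by (simp add: ennreal_mult[symmetric] powr_add[symmetric] algebra_simps)
      finally show ?thesis using True by simp
    next
      case False
      then have "- ball 0 1 \<inter> cball 0 s = ({} :: 'a set)" by auto
      then show ?thesis by simp
    qed
  qed
  also have "\<dots> = ennreal (q * ?V) * ennreal (1 / (q - ?p))"
    using nn_integral_powr_atLeast[of 1 "?p - q - 1"] q 
    by (subst nn_integral_cmult) (auto simp: field_simps minus_divide_right)
  also have "\<dots> = ennreal (q * ?V / (q - ?p))" using q q0 by (simp add: ennreal_mult[symmetric])
  finally show ?thesis .
qed

text \<open>The volume of the layer at \<open>s\<close> grows like \<open>s powr DIM('a)\<close> up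
  to \<open>s = 1\<close> and is constant afterwards, so \<open>q < DIM('a)\<close> gives
  convergence at 0 and \<open>q > 0\<close> at infinity.\<close>

lemma nn_integral_norm_powr_inside:
  fixes q :: real assumes q: "0 < q" "q < DIM('a::euclidean_space)"
  shows "(\<integral>\<^sup>+\<theta>. ennreal (norm \<theta> powr (-q)) * indicator (cball 0 1) \<theta> \<partial>(lborel :: 'a measure)) < \<infinity>"
proof -
  let ?p = "real DIM('a)" and ?V = "unit_ball_vol DIM('a)"
  have "(\<integral>\<^sup>+\<theta>. ennreal (norm \<theta> powr (-q)) * indicator (cball 0 1) \<theta> \<partial>(lborel :: 'a measure))
     \<le> (\<integral>\<^sup>+s. ennreal (q * ?V) * (ennreal (s powr (?p - q - 1)) * indicator {0..1} s) + 
          ennreal (q * ?V) * (ennreal (s powr (- q - 1)) * indicator {1..} s) \<partial>lborel)"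
  proof (subst nn_integral_norm_powr_layers[OF q(1)], simp, rule nn_integral_mono)
    fix s :: real
    consider "s \<le> 0" | "0 < s" "s \<le> 1" | "s > 1" by linarith
    then show "ennreal (q * s powr (-q - 1)) * indicator {0<..} s * emeasure lborel (cball 0 1 \<inter> cball 0 s :: 'a set)
      \<le> ennreal (q * ?V) * (ennreal (s powr (?p - q - 1)) * indicator {0..1} s) + 
          ennreal (q * ?V) * (ennreal (s powr (- q - 1)) * indicator {1..} s)"
    proof cases
      case 2
      have "emeasure lborel (cball 0 1 \<inter> cball 0 s :: 'a set) \<le> emeasure lborel (cball 0 s :: 'a set)"
        by (intro emeasure_mono) auto
      also have "\<dots> = ennreal (?V * s powr ?p)"
        using 2 by (simp add: emeasure_cball powr_realpow)
      finally have "ennreal (q * s powr (-q - 1)) * emeasure lborel (cball 0 1 \<inter> cball 0 s :: 'a set)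
         \<le> ennreal (q * s powr (-q - 1)) * ennreal (?V * s powr ?p)" by (intro mult_left_mono) auto
      also have "\<dots> = ennreal (q * ?V) * ennreal (s powr (?p - q - 1))"
        using q by (simp add: ennreal_mult[symmetric] powr_add[symmetric] algebra_simps)
      finally show ?thesis using 2 by (simp add: add_increasing2)
    next
      case 3
      have "emeasure lborel (cball 0 1 \<inter> cball 0 s :: 'a set) \<le> emeasure lborel (cball 0 1 :: 'a set)"
        by (intro emeasure_mono) auto
      also have "\<dots> = ennreal ?V" by (simp add: emeasure_cball)
      finally have "ennreal (q * s powr (-q - 1)) * emeasure lborel (cball 0 1 \<inter> cball 0 s :: 'a set)
         \<le> ennreal (q * s powr (-q - 1)) * ennreal ?V" by (intro mult_left_mono) auto
      also have "\<dots> = ennreal (q * ?V) * ennreal (s powr (- q - 1))"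
        using q by (simp add: ennreal_mult[symmetric] algebra_simps)
      finally show ?thesis using 3 by simp
    qed simp
  qed
  also have "\<dots> < \<infinity>"
    using nn_integral_powr_atLeast[of 1 "- q - 1"] q
      nn_integral_has_integral_lebesgue'[OF _ has_integral_powr_from_0[of "?p - q - 1" 1]]
    by (subst nn_integral_add) (auto simp: nn_integral_cmult ennreal_mult_less_top)
  finally show ?thesis .
qed

section \<open>Increments of negative powers\<close>

text \<open>The mean value theorem puts the derivative at the smaller of \<open>A\<close> and
  \<open>B\<close>; going back to \<open>A\<close> costs only a polynomial in \<open>z\<close>. With
  \<open>A = 1 + norm \<theta>\<close> and \<open>z = norm (x - \<theta>)\<close> the bound splits
  into a decay in \<theta> and a Gaussian moment.\<close>

lemma powr_neg_increment:
  fixes A B e z :: real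
  assumes A: "1 \<le> A" and B: "1 \<le> B" and AB: "\<bar>A - B\<bar> \<le> z" and e: "0 < e" "e \<le> 1"
  shows "\<bar>A powr (-e) - B powr (-e)\<bar> \<le> e * z * (1 + z)^2 * A powr (-1 - e)"
proof -
  have mvt: "m powr (-e) - M powr (-e) \<le> e * (M - m) * m powr (-1 - e)" if "1 \<le> m" "m \<le> M" for m M :: real
  proof (cases "m = M")
    case False
    have "\<And>s. m \<le> s \<Longrightarrow> s \<le> M \<Longrightarrow> ((\<lambda>s. s powr (-e)) has_real_derivative (-e * s powr (-1 - e))) (at s)"
      using that by (auto intro!: derivative_eq_intros simp: minus_diff_commute[of e 1])
    moreover have "m < M" using False that by simp
    ultimately obtain s where s: "m < s" "s < M"
      "M powr (-e) - m powr (-e) = (M - m) * (-e * s powr (-1 - e))"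
      using MVT2[of m M "\<lambda>s. s powr (-e)" "\<lambda>s. -e * s powr (-1 - e)"] by blast
    have "s powr (-1 - e) \<le> m powr (-1 - e)" using s that e by (intro powr_mono2') auto
    then have "e * (M - m) * s powr (-1 - e) \<le> e * (M - m) * m powr (-1 - e)"
      using that e by (intro mult_left_mono) auto
    then show ?thesis using s(3) by (simp add: algebra_simps)
  qed simp
  have z: "z \<ge> 0" using AB by linarith
  have key: "e * \<bar>A - B\<bar> * (min A B) powr (-1 - e) \<le> e * z * ((1 + z)^2 * A powr (-1 - e))"
  proof -
    \<comment> \<open>Since \<open>B \<ge> 1\<close>, \<open>A \<le> B + z\<close> becomes
      \<open>A \<le> B * (1 + z)\<close>, so the minimum is at least \<open>A / (1 + z)\<close>. The
      resulting power \<open>1 + e\<close> of \<open>1 + z\<close> is rounded up to 2.\<close>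
    have "A \<le> B + z * B" using AB B z mult_left_mono[of 1 B z] by linarith
    moreover have "A \<le> A + z * A" using A z by simp
    ultimately have "A / (1 + z) \<le> min A B" using z by (simp add: field_simps)
    then have "(min A B) powr (-1 - e) \<le> (A / (1 + z)) powr (-1 - e)"
      using A z e by (intro powr_mono2') auto
    also have "\<dots> = A powr (-1 - e) * (1 + z) powr (1 + e)"
      using A z powr_minus_divide[of "1 + z" "1 + e"] by (simp add: powr_divide)
    also have "\<dots> \<le> A powr (-1 - e) * (1 + z) powr 2"
      using A z e by (intro mult_left_mono powr_mono) auto
    finally have "(min A B) powr (-1 - e) \<le> (1 + z)^2 * A powr (-1 - e)"
      using z by (simp add: mult.commute)
    then show ?thesis using AB e z by (intro mult_mono) auto
  qed
  have "\<bar>A powr (-e) - B powr (-e)\<bar> \<le> e * \<bar>A - B\<bar> * (min A B) powr (-1 - e)"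
  proof (cases "A \<le> B")
    case True
    have "B powr (-e) \<le> A powr (-e)" using True A e by (intro powr_mono2') auto
    then show ?thesis using mvt[of A B] True A by (simp add: min_def abs_if)
  next
    case False
    have "A powr (-e) \<le> B powr (-e)" using False B e by (intro powr_mono2') auto
    then show ?thesis using mvt[of B A] False B by (simp add: min_def abs_if)
  qed
  with key show ?thesis by (simp add: mult.assoc)
qed

subsection \<open>Perturbing the posterior\<close>

text \<open>Under the posterior, \<open>expectation \<phi> - \<phi> \<theta>\<close> has mean zero,
  so the weight \<open>(u \<theta>)\<^sup>2\<close> in the cross term may be replaced by \<open>(u
  \<theta>)\<^sup>2 - m\<^sup>2 = (u \<theta> - m) * (u \<theta> + m)\<close> with \<open>m\<close>
  the mean of \<open>u\<close>. AM-GM then leaves a variance of \<open>u\<close>, and the mean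
  minimises over all centres \<open>v\<close>. Here \<open>\<tau>\<close> stands for the value of a
  competing estimator at one observation.\<close>

lemma (in prob_space) weighted_posterior_risk:
  fixes u \<phi> :: "'a \<Rightarrow> real" and \<tau> v :: real
  assumes [measurable]: "u \<in> borel_measurable M" "\<phi> \<in> borel_measurable M"
    and u: "\<And>\<theta>. \<theta> \<in> space M \<Longrightarrow> \<bar>u \<theta>\<bar> \<le> L" and \<phi>: "\<And>\<theta>. \<theta> \<in> space M \<Longrightarrow> \<bar>\<phi> \<theta>\<bar> \<le> K"
  shows "(\<integral>\<^sup>+\<theta>. ennreal ((u \<theta>)\<^sup>2 * (expectation \<phi> - \<phi> \<theta>)\<^sup>2) \<partial>M)
    \<le> (\<integral>\<^sup>+\<theta>. ennreal ((u \<theta>)\<^sup>2 * (\<tau> - \<phi> \<theta>)\<^sup>2) \<partial>M) + ennreal (16 * K\<^sup>2) * (\<integral>\<^sup>+\<theta>. ennreal ((u \<theta> - v)\<^sup>2) \<partial>M)"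
proof -
  define t where "t = expectation \<phi>"
  define m where "m = expectation u"
  define d where "d = t - \<tau>"
  obtain x where "x \<in> space M" using not_empty by blast
  then have K: "K \<ge> 0" and L: "L \<ge> 0" using u[of x] \<phi>[of x] by linarith+
  have bnd: "integrable M f" if "f \<in> borel_measurable M" "\<And>\<theta>. \<theta> \<in> space M \<Longrightarrow> \<bar>f \<theta>\<bar> \<le> B" for f :: "'a \<Rightarrow> real" and B
    using that by (intro integrable_const_bound[of _ B] AE_I2) simp_all
  have [simp]: "integrable M u" by (rule bnd[OF _ u]) simp
  have [simp]: "integrable M \<phi>" by (rule bnd[OF _ \<phi>]) simp
  have [simp]: "integrable M (\<lambda>\<theta>. (u \<theta>)\<^sup>2)"
  proof (rule bnd[of _ "L\<^sup>2"])
    fix \<theta> assume "\<theta> \<in> space M"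
    then have "\<bar>u \<theta>\<bar> \<le> \<bar>L\<bar>" using u[of \<theta>] by simp
    then show "\<bar>(u \<theta>)\<^sup>2\<bar> \<le> L\<^sup>2" by (simp add: abs_le_square_iff)
  qed simp
  have int1 [simp]: "integrable M (\<lambda>\<theta>. (u \<theta>)\<^sup>2 * (c - \<phi> \<theta>)\<^sup>2)" for c
  proof (rule bnd[of _ "L\<^sup>2 * (\<bar>c\<bar> + K)\<^sup>2"])
    fix \<theta> assume "\<theta> \<in> space M"
    then have "\<bar>u \<theta>\<bar> \<le> \<bar>L\<bar>" "\<bar>c - \<phi> \<theta>\<bar> \<le> \<bar>\<bar>c\<bar> + K\<bar>"
      using u[of \<theta>] \<phi>[of \<theta>] by linarith+
    then have "(u \<theta>)\<^sup>2 \<le> L\<^sup>2" "(c - \<phi> \<theta>)\<^sup>2 \<le> (\<bar>c\<bar> + K)\<^sup>2"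
      by (simp_all only: abs_le_square_iff)
    then show "\<bar>(u \<theta>)\<^sup>2 * (c - \<phi> \<theta>)\<^sup>2\<bar> \<le> L\<^sup>2 * (\<bar>c\<bar> + K)\<^sup>2"
      by (auto simp: abs_mult intro!: mult_mono)
  qed simp
  have sq [simp]: "integrable M (\<lambda>\<theta>. (u \<theta> - c)\<^sup>2)" for c
    by (simp add: power2_diff)
  have t: "\<bar>t\<bar> \<le> K" unfolding t_def
    by (rule order_trans[OF integral_abs_bound], rule integral_le_const) (auto intro: \<phi>)
  have m2: "m\<^sup>2 \<le> expectation (\<lambda>\<theta>. (u \<theta>)\<^sup>2)"
    using variance_positive[of u] by (simp add: m_def variance_eq)
  have var: "expectation (\<lambda>\<theta>. (u \<theta> - m)\<^sup>2) \<le> expectation (\<lambda>\<theta>. (u \<theta> - v)\<^sup>2)"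
  proof -
    have "expectation (\<lambda>\<theta>. (u \<theta> - c)\<^sup>2) = expectation (\<lambda>\<theta>. (u \<theta>)\<^sup>2) + c\<^sup>2 - 2 * c * m" for c
      by (simp add: power2_diff m_def prob_space algebra_simps)
    from this[of m] this[of v] show ?thesis
      using zero_le_power2[of "m - v"] by (simp add: power2_eq_square algebra_simps)
  qed
  \<comment> \<open>After integration the first term on the right is at most zero, as
    \<open>m\<^sup>2\<close> is at most the second moment of \<open>u\<close>, and the last one
    vanishes, as \<open>t\<close> is the mean of \<phi>.\<close>
  have pt: "(u \<theta>)\<^sup>2 * (t - \<phi> \<theta>)\<^sup>2 - (u \<theta>)\<^sup>2 * (\<tau> - \<phi> \<theta>)\<^sup>2
     \<le> d\<^sup>2 * (m\<^sup>2 - (u \<theta>)\<^sup>2) / 2 + 16 * K\<^sup>2 * (u \<theta> - m)\<^sup>2 + 2 * d * m\<^sup>2 * (t - \<phi> \<theta>)"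
    if \<theta>: "\<theta> \<in> space M" for \<theta>
  proof -
    define U F where "U = u \<theta>" and "F = t - \<phi> \<theta>"
    \<comment> \<open>The first AM-GM weight is chosen such that \<open>d\<^sup>2 (U\<^sup>2 + m\<^sup>2) / 2\<close> is absorbed by \<open>d\<^sup>2 U\<^sup>2\<close> on average.\<close>
    have "(d * (U + m) / 2 - 2 * F * (U - m))\<^sup>2 \<ge> 0" by simp
    then have 1: "2 * d * F * (U\<^sup>2 - m\<^sup>2) \<le> d\<^sup>2 * (U + m)\<^sup>2 / 4 + 4 * F\<^sup>2 * (U - m)\<^sup>2"
      by (simp add: power2_eq_square algebra_simps)
    have "d\<^sup>2 * (U - m)\<^sup>2 \<ge> 0" by simp
    then have 2: "d\<^sup>2 * (U + m)\<^sup>2 / 4 \<le> d\<^sup>2 * (U\<^sup>2 + m\<^sup>2) / 2"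
      by (simp add: power2_eq_square algebra_simps)
    \<comment> \<open>Both \<open>t\<close> and \<phi> lie within \<open>K\<close> of zero;
      \<open>4 * (2 * K)\<^sup>2\<close> is the source of the constant 16.\<close>
    have "\<bar>F\<bar> \<le> \<bar>2 * K\<bar>" using t \<phi>[OF \<theta>] K unfolding F_def by linarith
    then have "F\<^sup>2 \<le> (2 * K)\<^sup>2" by (simp only: abs_le_square_iff)
    then have 3: "4 * F\<^sup>2 * (U - m)\<^sup>2 \<le> 16 * K\<^sup>2 * (U - m)\<^sup>2"
      by (intro mult_right_mono) (auto simp: power_mult_distrib)
    have "U\<^sup>2 * (t - \<phi> \<theta>)\<^sup>2 - U\<^sup>2 * (\<tau> - \<phi> \<theta>)\<^sup>2 = 2 * d * F * (U\<^sup>2 - m\<^sup>2) + 2 * d * m\<^sup>2 * F - d\<^sup>2 * U\<^sup>2"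
      unfolding F_def d_def by (simp add: power2_eq_square algebra_simps)
    with 1 2 3 show ?thesis unfolding U_def[symmetric] F_def[symmetric]
      by (simp add: algebra_simps add_divide_distrib diff_divide_distrib)
  qed
  have "expectation (\<lambda>\<theta>. (u \<theta>)\<^sup>2 * (t - \<phi> \<theta>)\<^sup>2 - (u \<theta>)\<^sup>2 * (\<tau> - \<phi> \<theta>)\<^sup>2)
     \<le> expectation (\<lambda>\<theta>. d\<^sup>2 * (m\<^sup>2 - (u \<theta>)\<^sup>2) / 2 + 16 * K\<^sup>2 * (u \<theta> - m)\<^sup>2 + 2 * d * m\<^sup>2 * (t - \<phi> \<theta>))"
    using pt by (intro integral_mono) auto
  also have "\<dots> = d\<^sup>2 * (m\<^sup>2 - expectation (\<lambda>\<theta>. (u \<theta>)\<^sup>2)) / 2 + 16 * K\<^sup>2 * expectation (\<lambda>\<theta>. (u \<theta> - m)\<^sup>2)"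
    by (simp add: prob_space t_def)
  also have "\<dots> \<le> 0 + 16 * K\<^sup>2 * expectation (\<lambda>\<theta>. (u \<theta> - v)\<^sup>2)"
    using m2 var by (intro add_mono mult_left_mono) (auto intro!: divide_nonpos_pos mult_nonneg_nonpos)
  finally have "expectation (\<lambda>\<theta>. (u \<theta>)\<^sup>2 * (t - \<phi> \<theta>)\<^sup>2)
     \<le> expectation (\<lambda>\<theta>. (u \<theta>)\<^sup>2 * (\<tau> - \<phi> \<theta>)\<^sup>2) + 16 * K\<^sup>2 * expectation (\<lambda>\<theta>. (u \<theta> - v)\<^sup>2)"
    by simp
  then show ?thesis unfolding t_def[symmetric]
    by (simp add: nn_integral_eq_integral flip: ennreal_mult ennreal_plus)
qed

subsection \<open>Dominated models\<close>

text \<open>One dominating measure makes the joint measure a density on a product, so Tonelli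
  justifies every exchange of integrals. \<open>SX\<close> carries only the sigma-algebra of the
  sample space; integration over it is with respect to \<open>\<mu>\<close>.\<close>

locale dominated_model = pair_sigma_finite \<mu> \<nu>
  for \<mu> :: "'x measure" and \<nu> :: "'t measure" +
  fixes SX :: "'x measure" and P :: "'t \<Rightarrow> 'x measure" and f :: "'x \<Rightarrow> 't \<Rightarrow> ennreal"
  assumes sets_SX: "sets SX = sets \<mu>"
    and f_pair: "case_prod f \<in> borel_measurable (\<mu> \<Otimes>\<^sub>M \<nu>)"
    and P: "\<theta> \<in> space \<nu> \<Longrightarrow> P \<theta> = density \<mu> (\<lambda>x. f x \<theta>)"
begin

declare f_pair [measurable] sets_SX [measurable_cong]

lemma space_SX: "space SX = space \<mu>"
  using sets_SX by (rule sets_eq_imp_space_eq)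

lemma f_section [measurable]: "\<theta> \<in> space \<nu> \<Longrightarrow> (\<lambda>x. f x \<theta>) \<in> borel_measurable \<mu>"
  using measurable_compose[OF measurable_Pair2' f_pair] by simp

lemma nn_integral_model:
  assumes "\<theta> \<in> space \<nu>" "g \<in> borel_measurable \<mu>"
  shows "(\<integral>\<^sup>+x. g x \<partial>P \<theta>) = (\<integral>\<^sup>+x. f x \<theta> * g x \<partial>\<mu>)"
  using assms by (simp add: P nn_integral_density)

text \<open>\<open>measure_of\<close> yields the zero measure unless its set function is a measure.
  Identifying that function with a density shows that \<open>marginal\<close> has the intended
  values.\<close>

lemma marginal_eq_density: "marginal SX P \<nu> = density \<mu> (\<lambda>x. \<integral>\<^sup>+\<theta>. f x \<theta> \<partial>\<nu>)"
proof -
  have "(\<integral>\<^sup>+\<theta>. emeasure (P \<theta>) B \<partial>\<nu>) = emeasure (density \<mu> (\<lambda>x. \<integral>\<^sup>+\<theta>. f x \<theta> \<partial>\<nu>)) B"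
    if [measurable]: "B \<in> sets \<mu>" for B
  proof -
    have "(\<integral>\<^sup>+\<theta>. emeasure (P \<theta>) B \<partial>\<nu>) = (\<integral>\<^sup>+\<theta>. (\<integral>\<^sup>+x. f x \<theta> * indicator B x \<partial>\<mu>) \<partial>\<nu>)"
      by (intro nn_integral_cong) (simp add: P emeasure_density)
    also have "\<dots> = (\<integral>\<^sup>+x. (\<integral>\<^sup>+\<theta>. f x \<theta> * indicator B x \<partial>\<nu>) \<partial>\<mu>)"
      by (rule Fubini') measurable
    also have "\<dots> = (\<integral>\<^sup>+x. (\<integral>\<^sup>+\<theta>. f x \<theta> \<partial>\<nu>) * indicator B x \<partial>\<mu>)"
      by (intro nn_integral_cong nn_integral_multc) measurable
    also have "\<dots> = emeasure (density \<mu> (\<lambda>x. \<integral>\<^sup>+\<theta>. f x \<theta> \<partial>\<nu>)) B"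
      by (subst emeasure_density) auto
    finally show ?thesis .
  qed
  then have "marginal SX P \<nu> = measure_of (space \<mu>) (sets \<mu>) (emeasure (density \<mu> (\<lambda>x. \<integral>\<^sup>+\<theta>. f x \<theta> \<partial>\<nu>)))"
    unfolding marginal_def space_SX sets_SX
    by (intro measure_of_eq sets.space_closed) (simp add: sets.sigma_sets_eq)
  also have "\<dots> = density \<mu> (\<lambda>x. \<integral>\<^sup>+\<theta>. f x \<theta> \<partial>\<nu>)"
    using measure_of_of_measure[of "density \<mu> (\<lambda>x. \<integral>\<^sup>+\<theta>. f x \<theta> \<partial>\<nu>)"] by simp
  finally show ?thesis .
qed

section \<open>Existence of the formal posterior and disintegration\<close>

text \<open>Bayes' formula. The normaliser lies strictly between 0 and infinity at every
  \<open>x\<close>, not just almost every one, because a kernel into \<open>prob_algebra\<close>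
  must be a probability measure everywhere.\<close>

lemma formal_posterior_exists:
  assumes m: "\<And>x. x \<in> space \<mu> \<Longrightarrow> (\<integral>\<^sup>+\<theta>. f x \<theta> \<partial>\<nu>) \<noteq> 0" "\<And>x. x \<in> space \<mu> \<Longrightarrow> (\<integral>\<^sup>+\<theta>. f x \<theta> \<partial>\<nu>) \<noteq> \<infinity>"
  shows "formal_posterior SX P \<nu> (\<lambda>x. density \<nu> (\<lambda>\<theta>. f x \<theta> / (\<integral>\<^sup>+\<theta>. f x \<theta> \<partial>\<nu>)))"
proof -
  define m where "m x = (\<integral>\<^sup>+\<theta>. f x \<theta> \<partial>\<nu>)" for x
  have m_meas [measurable]: "m \<in> borel_measurable \<mu>" unfolding m_def by measurable
  have m0: "m x \<noteq> 0" and mt: "m x \<noteq> top" if "x \<in> space \<mu>" for x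
    using assms[OF that] by (auto simp: m_def)
  have f1 [measurable]: "(\<lambda>\<theta>. f x \<theta>) \<in> borel_measurable \<nu>" if "x \<in> space \<mu>" for x
    using measurable_compose[OF measurable_Pair1' f_pair] that by simp
  define Q where "Q x = density \<nu> (\<lambda>\<theta>. f x \<theta> / m x)" for x
  have "prob_space (Q x)" if "x \<in> space \<mu>" for x
  proof
    have "emeasure (Q x) (space (Q x)) = (\<integral>\<^sup>+\<theta>. f x \<theta> / m x \<partial>\<nu>)"
      using that by (simp add: Q_def emeasure_density cong: nn_integral_cong)
    also have "\<dots> = m x / m x"
      using that unfolding m_def by (intro nn_integral_divide) simp
    also have "\<dots> = 1" using m0 mt that by (simp add: ennreal_divide_self less_top)
    finally show "emeasure (Q x) (space (Q x)) = 1" .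
  qed
  moreover have "Q \<in> SX \<rightarrow>\<^sub>M subprob_algebra \<nu>"
  proof (rule measurable_subprob_algebra)
    fix A assume A [measurable]: "A \<in> sets \<nu>"
    have "(\<lambda>x. \<integral>\<^sup>+\<theta>. f x \<theta> / m x * indicator A \<theta> \<partial>\<nu>) \<in> borel_measurable \<mu>" by measurable
    also have "?this \<longleftrightarrow> (\<lambda>x. emeasure (Q x) A) \<in> borel_measurable SX"
      by (subst measurable_cong_sets[OF sets_SX refl], rule measurable_cong)
        (simp add: Q_def emeasure_density)
    finally show "(\<lambda>x. emeasure (Q x) A) \<in> borel_measurable SX" .
  next
    fix x assume "x \<in> space SX"
    with calculation show "subprob_space (Q x)" by (simp add: space_SX prob_space_imp_subprob_space)
  qed (simp add: Q_def)
  ultimately have "Q \<in> SX \<rightarrow>\<^sub>M prob_algebra \<nu>"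
    by (intro measurable_prob_algebraI) (simp_all add: space_SX)
  moreover have "(\<integral>\<^sup>+ \<theta>. (\<integral>\<^sup>+ x. indicator A (x, \<theta>) \<partial>P \<theta>) \<partial>\<nu>) =
        (\<integral>\<^sup>+ x. (\<integral>\<^sup>+ \<theta>. indicator A (x, \<theta>) \<partial>Q x) \<partial>marginal SX P \<nu>)" if "A \<in> sets (SX \<Otimes>\<^sub>M \<nu>)" for A
  proof -
    have [measurable]: "A \<in> sets (\<mu> \<Otimes>\<^sub>M \<nu>)" using that sets_pair_measure_cong[OF sets_SX refl, of \<nu>] by simp
    have A2: "(\<lambda>\<theta>. indicator A (x, \<theta>) :: ennreal) \<in> borel_measurable \<nu>" if "x \<in> space \<mu>" for x
      using that by measurable
    have "(\<integral>\<^sup>+ \<theta>. (\<integral>\<^sup>+ x. indicator A (x, \<theta>) \<partial>P \<theta>) \<partial>\<nu>) = (\<integral>\<^sup>+ \<theta>. (\<integral>\<^sup>+ x. f x \<theta> * indicator A (x, \<theta>) \<partial>\<mu>) \<partial>\<nu>)"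
      by (intro nn_integral_cong nn_integral_model) measurable
    also have "\<dots> = (\<integral>\<^sup>+ x. (\<integral>\<^sup>+ \<theta>. f x \<theta> * indicator A (x, \<theta>) \<partial>\<nu>) \<partial>\<mu>)"
      by (rule Fubini') measurable
    also have "\<dots> = (\<integral>\<^sup>+ x. m x * (\<integral>\<^sup>+ \<theta>. indicator A (x, \<theta>) \<partial>Q x) \<partial>\<mu>)"
    proof (rule nn_integral_cong)
      fix x assume x: "x \<in> space \<mu>"
      have "(\<integral>\<^sup>+ \<theta>. f x \<theta> * indicator A (x, \<theta>) \<partial>\<nu>) = (\<integral>\<^sup>+ \<theta>. m x * (f x \<theta> / m x * indicator A (x, \<theta>)) \<partial>\<nu>)"
        using m0[OF x] mt[OF x]
        by (intro nn_integral_cong) (simp add: mult.assoc[symmetric] ennreal_times_divide ennreal_mult_divide_eq mult.commute[of "m x"])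
      also have "\<dots> = m x * (\<integral>\<^sup>+ \<theta>. f x \<theta> / m x * indicator A (x, \<theta>) \<partial>\<nu>)"
        using x A2 by (intro nn_integral_cmult) measurable
      also have "(\<integral>\<^sup>+ \<theta>. f x \<theta> / m x * indicator A (x, \<theta>) \<partial>\<nu>) = (\<integral>\<^sup>+ \<theta>. indicator A (x, \<theta>) \<partial>Q x)"
        unfolding Q_def using x A2 by (subst nn_integral_density) auto
      finally show "(\<integral>\<^sup>+ \<theta>. f x \<theta> * indicator A (x, \<theta>) \<partial>\<nu>) = m x * (\<integral>\<^sup>+ \<theta>. indicator A (x, \<theta>) \<partial>Q x)" .
    qed
    also have "\<dots> = (\<integral>\<^sup>+ x. (\<integral>\<^sup>+ \<theta>. indicator A (x, \<theta>) \<partial>Q x) \<partial>marginal SX P \<nu>)"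
    proof -
      have "(\<lambda>x. \<integral>\<^sup>+ \<theta>. indicator A (x, \<theta>) \<partial>Q x) \<in> borel_measurable SX"
        using that by (intro nn_integral_measurable_subprob_algebra2[OF _ \<open>Q \<in> SX \<rightarrow>\<^sub>M subprob_algebra \<nu>\<close>]) measurable
      then show ?thesis
        unfolding marginal_eq_density m_def[symmetric]
        by (subst nn_integral_density) (auto simp: measurable_cong_sets[OF sets_SX refl])
    qed
    finally show ?thesis .
  qed
  ultimately show ?thesis unfolding formal_posterior_def Q_def m_def by blast
qed

text \<open>Both iterated integrals are integrals against measures on the product, \<open>J\<close>
  with density \<open>f\<close> and \<open>K\<close> composed from the marginal and the kernel. The
  definition of a formal posterior says that \<open>J\<close> and \<open>K\<close> agree on
  measurable sets, hence they are equal and all nonnegative integrands follow.\<close>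

lemma nn_integral_disintegrate:
  assumes Q: "formal_posterior SX P \<nu> Q" and F: "F \<in> borel_measurable (SX \<Otimes>\<^sub>M \<nu>)"
  shows "(\<integral>\<^sup>+ \<theta>. (\<integral>\<^sup>+ x. F (x, \<theta>) \<partial>P \<theta>) \<partial>\<nu>) = (\<integral>\<^sup>+ x. (\<integral>\<^sup>+ \<theta>. F (x, \<theta>) \<partial>Q x) \<partial>marginal SX P \<nu>)"
proof -
  have sM: "sets (marginal SX P \<nu>) = sets SX" by (simp add: marginal_eq_density sets_SX)
  have SX': "sets (SX \<Otimes>\<^sub>M \<nu>) = sets (\<mu> \<Otimes>\<^sub>M \<nu>)" by (intro sets_pair_measure_cong sets_SX refl)
  define J where "J = density (\<mu> \<Otimes>\<^sub>M \<nu>) (case_prod f)"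
  define K where "K = marginal SX P \<nu> \<bind> (\<lambda>x. distr (Q x) (SX \<Otimes>\<^sub>M \<nu>) (Pair x))"
  have Q_meas: "Q \<in> SX \<rightarrow>\<^sub>M subprob_algebra \<nu>"
    using Q by (auto simp: formal_posterior_def intro: measurable_prob_algebraD)
  have sQ: "sets (Q x) = sets \<nu>" if "x \<in> space SX" for x
    using Q that by (auto simp: formal_posterior_def space_prob_algebra dest: measurable_space)
  have joint: "(\<integral>\<^sup>+ \<theta>. (\<integral>\<^sup>+ x. G (x, \<theta>) \<partial>P \<theta>) \<partial>\<nu>) = integral\<^sup>N J G"
    if G: "G \<in> borel_measurable (SX \<Otimes>\<^sub>M \<nu>)" for G
  proof -
    have [measurable]: "G \<in> borel_measurable (\<mu> \<Otimes>\<^sub>M \<nu>)" using G measurable_cong_sets[OF SX' refl] by simp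
    have "integral\<^sup>N J G = (\<integral>\<^sup>+z. case_prod f z * G z \<partial>(\<mu> \<Otimes>\<^sub>M \<nu>))"
      unfolding J_def by (intro nn_integral_density) measurable
    also have "\<dots> = (\<integral>\<^sup>+ \<theta>. (\<integral>\<^sup>+ x. f x \<theta> * G (x, \<theta>) \<partial>\<mu>) \<partial>\<nu>)"
      by (subst nn_integral_snd[symmetric]) auto
    also have "\<dots> = (\<integral>\<^sup>+ \<theta>. (\<integral>\<^sup>+ x. G (x, \<theta>) \<partial>P \<theta>) \<partial>\<nu>)"
      by (intro nn_integral_cong nn_integral_model[symmetric]) measurable
    finally show ?thesis by simp
  qed
  have kern: "(\<lambda>x. distr (Q x) (SX \<Otimes>\<^sub>M \<nu>) (Pair x)) \<in> marginal SX P \<nu> \<rightarrow>\<^sub>M subprob_algebra (SX \<Otimes>\<^sub>M \<nu>)"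
    unfolding measurable_cong_sets[OF sM refl] by (rule measurable_distr2[OF _ Q_meas]) simp
  have kernel_int: "(\<integral>\<^sup>+ x. (\<integral>\<^sup>+ \<theta>. G (x, \<theta>) \<partial>Q x) \<partial>marginal SX P \<nu>) = integral\<^sup>N K G"
    if G: "G \<in> borel_measurable (SX \<Otimes>\<^sub>M \<nu>)" for G
    unfolding K_def
  proof (subst nn_integral_bind[OF G kern], rule nn_integral_cong)
    fix x assume "x \<in> space (marginal SX P \<nu>)"
    then have "x \<in> space SX" using sets_eq_imp_space_eq[OF sM] by simp
    then show "(\<integral>\<^sup>+ \<theta>. G (x, \<theta>) \<partial>Q x) = integral\<^sup>N (distr (Q x) (SX \<Otimes>\<^sub>M \<nu>) (Pair x)) G"
      using G \<open>x \<in> space SX\<close> by (subst nn_integral_distr) (simp_all add: measurable_cong_sets[OF sQ refl])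
  qed
  \<comment> \<open>\<open>bind\<close> has a default value on an empty space, so that case is
    separate; both sides are then integrals over empty spaces.\<close>
  show ?thesis
  proof (cases "space SX = {}")
    case True
    then have "space (P \<theta>) = {}" if "\<theta> \<in> space \<nu>" for \<theta> using that by (simp add: P space_SX)
    moreover have "space (marginal SX P \<nu>) = {}" using True sets_eq_imp_space_eq[OF sM] by simp
    ultimately show ?thesis by (simp add: nn_integral_empty cong: nn_integral_cong)
  next
    case False
    have "J = K"
    proof (rule measure_eqI)
      have "sets K = sets (SX \<Otimes>\<^sub>M \<nu>)"
        unfolding K_def using False sets_eq_imp_space_eq[OF sM] by (intro sets_bind) auto
      then show sJK: "sets J = sets K" by (simp add: J_def SX')
      fix A assume "A \<in> sets J"
      then have A: "A \<in> sets (SX \<Otimes>\<^sub>M \<nu>)" "A \<in> sets K" using SX' sJK by (auto simp: J_def)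
      then have "integral\<^sup>N J (indicator A) = integral\<^sup>N K (indicator A)"
        using Q A(1) joint[of "indicator A"] kernel_int[of "indicator A"] by (simp add: formal_posterior_def)
      then show "emeasure J A = emeasure K A" using A \<open>A \<in> sets J\<close> by simp
    qed
    then show ?thesis using joint[OF F] kernel_int[OF F] by simp
qed
qed

section \<open>Blyth's criterion\<close>

text \<open>The test function \<open>u\<close> is at least 1 on \<open>C n\<close>, so the gain of a
  dominating estimator over \<open>C n\<close> is at most its gain under the prior weighted by
  \<open>(u \<theta>)\<^sup>2\<close>, which the energy controls. Square integrability makes the
  weighted risks finite, so that they can be subtracted. The condition on \<open>u\<close> and
  \<open>v\<close> involves the model and the prior alone, and therefore serves every posterior and
  every \<phi>.\<close>

lemma almost_admissible_blyth:
  fixes \<phi> :: "'t \<Rightarrow> real" and C :: "nat \<Rightarrow> 't set" and B :: real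
  assumes Q: "formal_posterior SX P \<nu> Q"
    and \<phi>_meas: "\<phi> \<in> borel_measurable \<nu>" and bdd: "bounded (\<phi> ` space \<nu>)"
    and mass: "\<And>\<theta>. \<theta> \<in> space \<nu> \<Longrightarrow> emeasure (P \<theta>) (space \<mu>) \<le> ennreal B"
    and C: "\<And>n. C n \<in> sets \<nu>" "space \<nu> \<subseteq> (\<Union>n. C n)"
    and test: "\<And>n e. e > 0 \<Longrightarrow> \<exists>u v L. u \<in> borel_measurable \<nu> \<and> v \<in> borel_measurable SX \<and>
      (\<forall>\<theta>\<in>space \<nu>. \<bar>u \<theta>\<bar> \<le> L) \<and> (\<forall>\<theta>\<in>C n. 1 \<le> \<bar>u \<theta>\<bar>) \<and>
      (\<integral>\<^sup>+\<theta>. ennreal ((u \<theta>)\<^sup>2) \<partial>\<nu>) < \<infinity> \<and>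
      (\<integral>\<^sup>+\<theta>. (\<integral>\<^sup>+x. ennreal ((u \<theta> - v x)\<^sup>2) \<partial>P \<theta>) \<partial>\<nu>) \<le> ennreal e"
  shows "almost_admissible SX P \<nu> \<phi> (\<lambda>x. \<integral>\<theta>. \<phi> \<theta> \<partial>Q x)"
  unfolding almost_admissible_def
proof (intro ballI impI)
  fix t :: "'x \<Rightarrow> real"
  assume t_meas: "t \<in> borel_measurable SX"
  define t0 where "t0 x = (\<integral>\<theta>. \<phi> \<theta> \<partial>Q x)" for x
  assume "\<forall>\<theta>\<in>space \<nu>. risk P \<phi> t \<theta> \<le> risk P \<phi> (\<lambda>x. \<integral>\<theta>. \<phi> \<theta> \<partial>Q x) \<theta>"
  then have dom: "risk P \<phi> t \<theta> \<le> risk P \<phi> t0 \<theta>" if "\<theta> \<in> space \<nu>" for \<theta>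
    using that by (simp add: t0_def[abs_def])
  note [measurable] = \<phi>_meas t_meas C(1)
  obtain K where K: "K > 0" "\<And>\<theta>. \<theta> \<in> space \<nu> \<Longrightarrow> \<bar>\<phi> \<theta>\<bar> \<le> K"
    using bdd unfolding bounded_pos by auto
  have sM: "sets (marginal SX P \<nu>) = sets SX" by (simp add: marginal_eq_density sets_SX)
  have Q_meas [measurable]: "Q \<in> SX \<rightarrow>\<^sub>M subprob_algebra \<nu>"
    using Q by (auto simp: formal_posterior_def intro: measurable_prob_algebraD)
  have Qx: "sets (Q x) = sets \<nu>" "space (Q x) = space \<nu>" "prob_space (Q x)" if "x \<in> space SX" for x
  proof -
    have "Q x \<in> space (prob_algebra \<nu>)"
      using Q that unfolding formal_posterior_def by (blast dest: measurable_space)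
    then show "sets (Q x) = sets \<nu>" "prob_space (Q x)" by (auto simp: space_prob_algebra)
    then show "space (Q x) = space \<nu>" by (intro sets_eq_imp_space_eq)
  qed
  have t0_meas [measurable]: "t0 \<in> borel_measurable SX"
    unfolding t0_def[abs_def] by (rule measurable_compose[OF Q_meas integral_measurable_subprob_algebra[OF \<phi>_meas]])
  have t0_bound: "\<bar>t0 x\<bar> \<le> K" if "x \<in> space SX" for x
  proof -
    interpret prob_space "Q x" using Qx that by simp
    have "\<phi> \<in> borel_measurable (Q x)" using \<phi>_meas by (simp add: measurable_cong_sets[OF Qx(1)[OF that] refl])
    then have "integrable (Q x) \<phi>"
      using Qx[OF that] K by (intro integrable_const_bound[of _ K] AE_I2) auto
    then show ?thesis unfolding t0_def
      by (intro order_trans[OF integral_abs_bound] integral_le_const AE_I2) (auto simp: Qx[OF that] K)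
  qed
  have risk_meas: "risk P \<phi> s \<in> borel_measurable \<nu>" if [measurable]: "s \<in> borel_measurable SX" for s
  proof -
    have "(\<lambda>\<theta>. \<integral>\<^sup>+x. f x \<theta> * ennreal ((s x - \<phi> \<theta>)\<^sup>2) \<partial>\<mu>) \<in> borel_measurable \<nu>" by measurable
    also have "?this \<longleftrightarrow> ?thesis"
      by (rule measurable_cong) (simp add: risk_def nn_integral_model)
    finally show ?thesis .
  qed
  note [measurable] = risk_meas[OF t_meas] risk_meas[OF t0_meas]
  define N where "N = {\<theta> \<in> space \<nu>. risk P \<phi> t \<theta> < risk P \<phi> t0 \<theta>}"
  have N [measurable]: "N \<in> sets \<nu>" unfolding N_def by measurable
  \<comment> \<open>Both \<open>t0\<close> and \<phi> are bounded by \<open>K\<close>, so the loss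
    is at most \<open>(2 * K)\<^sup>2\<close>; the total mass contributes \<open>B\<close>.\<close>
  have risk_fin: "risk P \<phi> t0 \<theta> \<le> ennreal ((2 * K)\<^sup>2 * B)" if \<theta>: "\<theta> \<in> space \<nu>" for \<theta>
  proof -
    have sP: "space (P \<theta>) = space \<mu>" using P[OF \<theta>] by simp
    have "risk P \<phi> t0 \<theta> \<le> (\<integral>\<^sup>+x. ennreal ((2 * K)\<^sup>2) \<partial>P \<theta>)"
      unfolding risk_def
    proof (intro nn_integral_mono ennreal_leI)
      fix x assume "x \<in> space (P \<theta>)"
      then have "\<bar>t0 x - \<phi> \<theta>\<bar> \<le> \<bar>2 * K\<bar>" using t0_bound[of x] K(2)[OF \<theta>] sP space_SX by simp
      then show "(t0 x - \<phi> \<theta>)\<^sup>2 \<le> (2 * K)\<^sup>2" by (simp only: abs_le_square_iff)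
    qed
    also have "\<dots> \<le> ennreal ((2 * K)\<^sup>2) * ennreal B"
      using mass[OF \<theta>] sP by (simp add: mult_left_mono)
    finally show ?thesis by (simp add: ennreal_mult')
  qed
  have small: "(\<integral>\<^sup>+\<theta>. (risk P \<phi> t0 \<theta> - risk P \<phi> t \<theta>) * indicator (C n) \<theta> \<partial>\<nu>) \<le> ennreal e"
    if e: "e > 0" for n and e :: real
  proof -
    \<comment> \<open>The factor \<open>16 * K\<^sup>2\<close> from
      \<open>weighted_posterior_risk\<close> is divided out in advance; \<open>K\<close> was chosen
      positive for this.\<close>
    have "e / (16 * K\<^sup>2) > 0" using e K(1) by simp
    from test[OF this, of n] obtain u v L where u_meas [measurable]: "u \<in> borel_measurable \<nu>" and [measurable]: "v \<in> borel_measurable SX"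
      and uL: "\<forall>\<theta>\<in>space \<nu>. \<bar>u \<theta>\<bar> \<le> L" and u1: "\<forall>\<theta>\<in>C n. 1 \<le> \<bar>u \<theta>\<bar>"
      and ufin: "(\<integral>\<^sup>+\<theta>. ennreal ((u \<theta>)\<^sup>2) \<partial>\<nu>) < \<infinity>"
      and D: "(\<integral>\<^sup>+\<theta>. (\<integral>\<^sup>+x. ennreal ((u \<theta> - v x)\<^sup>2) \<partial>P \<theta>) \<partial>\<nu>) \<le> ennreal (e / (16 * K\<^sup>2))"
      by (elim exE conjE) (rule that)
    define R where "R s = (\<integral>\<^sup>+\<theta>. ennreal ((u \<theta>)\<^sup>2) * risk P \<phi> s \<theta> \<partial>\<nu>)" for s
    have R_eq: "R s = (\<integral>\<^sup>+x. (\<integral>\<^sup>+\<theta>. ennreal ((u \<theta>)\<^sup>2 * (s x - \<phi> \<theta>)\<^sup>2) \<partial>Q x) \<partial>marginal SX P \<nu>)"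
      if s [measurable]: "s \<in> borel_measurable SX" for s
    proof -
      have "R s = (\<integral>\<^sup>+\<theta>. (\<integral>\<^sup>+x. ennreal ((u \<theta>)\<^sup>2 * (s x - \<phi> \<theta>)\<^sup>2) \<partial>P \<theta>) \<partial>\<nu>)"
        unfolding R_def risk_def
        by (intro nn_integral_cong, subst nn_integral_cmult[symmetric])
          (auto simp: P ennreal_mult)
      also have "\<dots> = (\<integral>\<^sup>+x. (\<integral>\<^sup>+\<theta>. ennreal ((u \<theta>)\<^sup>2 * (s x - \<phi> \<theta>)\<^sup>2) \<partial>Q x) \<partial>marginal SX P \<nu>)"
        using nn_integral_disintegrate[OF Q, of "\<lambda>(x, \<theta>). ennreal ((u \<theta>)\<^sup>2 * (s x - \<phi> \<theta>)\<^sup>2)"] by simp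
      finally show ?thesis .
    qed
    have kint: "(\<lambda>x. \<integral>\<^sup>+\<theta>. g x \<theta> \<partial>Q x) \<in> borel_measurable (marginal SX P \<nu>)"
      if "(\<lambda>(x, \<theta>). g x \<theta>) \<in> borel_measurable (SX \<Otimes>\<^sub>M \<nu>)" for g :: "'x \<Rightarrow> 't \<Rightarrow> ennreal"
      using nn_integral_measurable_subprob_algebra2[OF that Q_meas] by (simp add: measurable_cong_sets[OF sM refl])
    \<comment> \<open>At each \<open>x\<close> the posterior inequality is applied with
      \<open>\<tau> = t x\<close> and centre \<open>v x\<close>, and the result is integrated over
      the marginal.\<close>
    have "R t0 \<le> (\<integral>\<^sup>+x. (\<integral>\<^sup>+\<theta>. ennreal ((u \<theta>)\<^sup>2 * (t x - \<phi> \<theta>)\<^sup>2) \<partial>Q x) +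
        ennreal (16 * K\<^sup>2) * (\<integral>\<^sup>+\<theta>. ennreal ((u \<theta> - v x)\<^sup>2) \<partial>Q x) \<partial>marginal SX P \<nu>)"
      unfolding R_eq[OF t0_meas]
    proof (rule nn_integral_mono)
      fix x assume "x \<in> space (marginal SX P \<nu>)"
      then have x: "x \<in> space SX" using sets_eq_imp_space_eq[OF sM] by simp
      interpret prob_space "Q x" using Qx x by simp
      show "(\<integral>\<^sup>+\<theta>. ennreal ((u \<theta>)\<^sup>2 * (t0 x - \<phi> \<theta>)\<^sup>2) \<partial>Q x) \<le> (\<integral>\<^sup>+\<theta>. ennreal ((u \<theta>)\<^sup>2 * (t x - \<phi> \<theta>)\<^sup>2) \<partial>Q x) +
        ennreal (16 * K\<^sup>2) * (\<integral>\<^sup>+\<theta>. ennreal ((u \<theta> - v x)\<^sup>2) \<partial>Q x)"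
        unfolding t0_def
        by (rule weighted_posterior_risk[where L = L]) (use uL K u_meas \<phi>_meas in \<open>auto simp: Qx[OF x] measurable_cong_sets[OF Qx(1)[OF x] refl]\<close>)
    qed
    also have "\<dots> = R t + ennreal (16 * K\<^sup>2) *
       (\<integral>\<^sup>+x. (\<integral>\<^sup>+\<theta>. ennreal ((u \<theta> - v x)\<^sup>2) \<partial>Q x) \<partial>marginal SX P \<nu>)"
      unfolding R_eq[OF t_meas]
      by (subst nn_integral_add, intro kint, measurable, intro borel_measurable_times borel_measurable_const kint,
          measurable, subst nn_integral_cmult, intro kint, measurable)
    \<comment> \<open>Disintegration is read backwards here, which removes the posterior from the
      error term.\<close>
    also have "(\<integral>\<^sup>+x. (\<integral>\<^sup>+\<theta>. ennreal ((u \<theta> - v x)\<^sup>2) \<partial>Q x) \<partial>marginal SX P \<nu>) =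
       (\<integral>\<^sup>+\<theta>. (\<integral>\<^sup>+x. ennreal ((u \<theta> - v x)\<^sup>2) \<partial>P \<theta>) \<partial>\<nu>)"
      using nn_integral_disintegrate[OF Q, of "\<lambda>(x, \<theta>). ennreal ((u \<theta> - v x)\<^sup>2)"] by simp
    also have "R t + ennreal (16 * K\<^sup>2) * \<dots> \<le> R t + ennreal (16 * K\<^sup>2) * ennreal (e / (16 * K\<^sup>2))"
      using D by (intro add_left_mono mult_left_mono) auto
    also have "\<dots> = R t + ennreal e" using e K(1) by (simp flip: ennreal_mult)
    finally have R: "R t0 \<le> R t + ennreal e" .
    have R_le: "ennreal ((u \<theta>)\<^sup>2) * risk P \<phi> t \<theta> \<le> ennreal ((u \<theta>)\<^sup>2) * risk P \<phi> t0 \<theta>" if "\<theta> \<in> space \<nu>" for \<theta>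
      using dom[OF that] by (intro mult_left_mono) auto
    have "R t0 \<le> (\<integral>\<^sup>+\<theta>. ennreal ((u \<theta>)\<^sup>2) * ennreal ((2 * K)\<^sup>2 * B) \<partial>\<nu>)"
      unfolding R_def by (intro nn_integral_mono mult_left_mono risk_fin) auto
    also have "\<dots> < \<infinity>" using ufin by (simp add: nn_integral_multc ennreal_mult_less_top)
    finally have R0_fin: "R t0 < \<infinity>" .
    have "R t \<le> R t0" unfolding R_def by (intro nn_integral_mono R_le)
    with R0_fin have R_fin: "R t \<noteq> \<infinity>" by auto
    have "(\<integral>\<^sup>+\<theta>. (risk P \<phi> t0 \<theta> - risk P \<phi> t \<theta>) * indicator (C n) \<theta> \<partial>\<nu>)
      \<le> (\<integral>\<^sup>+\<theta>. ennreal ((u \<theta>)\<^sup>2) * risk P \<phi> t0 \<theta> - ennreal ((u \<theta>)\<^sup>2) * risk P \<phi> t \<theta> \<partial>\<nu>)"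
    proof (rule nn_integral_mono)
      fix \<theta> assume \<theta>: "\<theta> \<in> space \<nu>"
      have fin: "risk P \<phi> t \<theta> < \<infinity>"
        using order.trans[OF dom[OF \<theta>] risk_fin[OF \<theta>]] by (auto simp: less_top[symmetric] top_unique)
      have "(risk P \<phi> t0 \<theta> - risk P \<phi> t \<theta>) * indicator (C n) \<theta> \<le> ennreal ((u \<theta>)\<^sup>2) * (risk P \<phi> t0 \<theta> - risk P \<phi> t \<theta>)"
      proof (cases "\<theta> \<in> C n")
        case True
        then have "1 \<le> (u \<theta>)\<^sup>2" using bspec[OF u1 True] one_le_power[of "\<bar>u \<theta>\<bar>" 2] by simp
        then have "1 \<le> ennreal ((u \<theta>)\<^sup>2)" by simp
        from mult_right_mono[OF this] show ?thesis using True by simp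
      qed simp
      also have "\<dots> = ennreal ((u \<theta>)\<^sup>2) * risk P \<phi> t0 \<theta> - ennreal ((u \<theta>)\<^sup>2) * risk P \<phi> t \<theta>"
        using fin by (intro ennreal_right_diff_distrib) auto
      finally show "(risk P \<phi> t0 \<theta> - risk P \<phi> t \<theta>) * indicator (C n) \<theta> \<le> \<dots>" .
    qed
    also have "\<dots> = R t0 - R t"
      unfolding R_def
      by (rule nn_integral_diff) (use R_fin R_le in \<open>auto simp: R_def\<close>)
    also have "\<dots> \<le> ennreal e" using R R_fin by (simp add: ennreal_minus_le_iff)
    finally show ?thesis .
  qed
  \<comment> \<open>The previous bound holds for every \<open>e\<close>, so the integral is zero and
    the risks agree almost everywhere on \<open>C n\<close>; countably many \<open>C n\<close> cover
    the space.\<close>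
  have "N \<inter> C n \<in> null_sets \<nu>" for n
  proof -
    have "(\<integral>\<^sup>+\<theta>. (risk P \<phi> t0 \<theta> - risk P \<phi> t \<theta>) * indicator (C n) \<theta> \<partial>\<nu>) = 0"
      using small[of _ n] by (metis ennreal_le_epsilon add_0 le_zero_eq)
    then have "AE \<theta> in \<nu>. (risk P \<phi> t0 \<theta> - risk P \<phi> t \<theta>) * indicator (C n) \<theta> = 0"
      by (subst (asm) nn_integral_0_iff_AE) auto
    then have "AE \<theta> in \<nu>. \<theta> \<notin> N \<inter> C n"
      by (rule AE_mp) (auto intro!: AE_I2 simp: N_def indicator_def diff_eq_0_iff_ennreal)
    then show ?thesis by (subst (asm) AE_iff_null_sets[symmetric]) auto
  qed
  then have "(\<Union>n. N \<inter> C n) \<in> null_sets \<nu>" by (intro null_sets_UN) auto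
  moreover have "N \<subseteq> (\<Union>n. N \<inter> C n)" using C(2) by (auto simp: N_def)
  ultimately show "\<exists>N\<in>null_sets \<nu>. {\<theta> \<in> space \<nu>. risk P \<phi> t \<theta> < risk P \<phi> (\<lambda>x. \<integral>\<theta>. \<phi> \<theta> \<partial>Q x) \<theta>} \<subseteq> N"
    unfolding N_def t0_def[abs_def] by blast
qed
end

subsection \<open>The prior near the origin and at infinity\<close>

definition prior_density :: "real \<Rightarrow> real \<Rightarrow> 'a::euclidean_space \<Rightarrow> real" where
  "prior_density a b \<theta> = (a + (norm \<theta>)\<^sup>2) powr (- b)"

lemma prior_density_measurable [measurable]: "prior_density a b \<in> borel_measurable borel"
  unfolding prior_density_def by measurable

lemma prior_density_nonneg: "0 \<le> prior_density a b \<theta>"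
  by (simp add: prior_density_def)

text \<open>Away from the origin, dropping \<open>a\<close> only enlarges the density, and the lower
  bound on \<open>b\<close> says that \<open>2 * b\<close> is at least \<open>DIM('a) - 2\<close>.
  The radial mass of the bound is proportional to \<open>s ds\<close>, that of Lebesgue measure in
  the plane.\<close>

lemma prior_density_le_outside:
  fixes \<theta> :: "'a::euclidean_space"
  assumes "DIM('a) \<ge> 2" "a \<ge> 0" "real DIM('a) / 2 - 1 \<le> b" "1 \<le> norm \<theta>"
  shows "prior_density a b \<theta> \<le> norm \<theta> powr (2 - real DIM('a))"
proof -
  have b: "b \<ge> 0" using assms(1,3) by linarith
  have n: "1 \<le> (norm \<theta>)\<^sup>2" using assms(4) by simp
  have "prior_density a b \<theta> \<le> ((norm \<theta>)\<^sup>2) powr (- b)"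
    unfolding prior_density_def using n assms(2) b by (intro powr_mono2') auto
  also have "\<dots> \<le> ((norm \<theta>)\<^sup>2) powr (1 - real DIM('a) / 2)"
    using n assms(3) by (intro powr_mono) auto
  also have "\<dots> = norm \<theta> powr (2 * (1 - real DIM('a) / 2))"
  proof -
    have "(norm \<theta>)\<^sup>2 = norm \<theta> powr 2" using assms(4) by simp
    then show ?thesis by (simp only: powr_powr)
  qed
  finally show ?thesis by (simp add: algebra_simps)
qed

lemma prior_density_le_one:
  fixes \<theta> :: "'a::euclidean_space"
  assumes "DIM('a) \<ge> 2" "a \<ge> 0" "real DIM('a) / 2 - 1 \<le> b" "1 \<le> norm \<theta>"
  shows "prior_density a b \<theta> \<le> 1"
proof -
  have "norm \<theta> powr (2 - real DIM('a)) \<le> norm \<theta> powr 0"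
    using assms by (intro powr_mono) auto
  also have "\<dots> = 1" using assms(4) by auto
  finally show ?thesis using prior_density_le_outside[OF assms] by linarith
qed

text \<open>For \<open>a > 0\<close> the density is bounded by \<open>a powr (-b)\<close>. For
  \<open>a = 0\<close> it has a singularity of order \<open>2 * b\<close> at the origin, integrable
  because that order is below the dimension.\<close>

lemma prior_unit_ball_finite:
  assumes "b > 0" "a > 0 \<or> (a = 0 \<and> 2 * b < real DIM('a::euclidean_space))"
  shows "(\<integral>\<^sup>+\<theta>. ennreal (prior_density a b \<theta>) * indicator (cball 0 1) \<theta> \<partial>(lborel :: 'a measure)) < \<infinity>"
proof (cases "a > 0")
  case True
  have "(\<integral>\<^sup>+\<theta>. ennreal (prior_density a b \<theta>) * indicator (cball 0 1) \<theta> \<partial>(lborel :: 'a measure))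
      \<le> (\<integral>\<^sup>+\<theta>. ennreal (a powr (-b)) * indicator (cball 0 1) \<theta> \<partial>(lborel :: 'a measure))"
    using assms True unfolding prior_density_def
    by (intro nn_integral_mono mult_right_mono ennreal_leI powr_mono2') auto
  also have "\<dots> < \<infinity>"
    by (simp add: nn_integral_cmult_indicator emeasure_cball ennreal_mult_less_top)
  finally show ?thesis .
next
  case False
  \<comment> \<open>At the origin both sides take the default value of \<open>0 powr\<close>, which
    is 0.\<close>
  have "prior_density 0 b \<theta> = norm \<theta> powr (- (2 * b))" for \<theta> :: 'a
  proof (cases "\<theta> = 0")
    case False
    then have "(norm \<theta>)\<^sup>2 = norm \<theta> powr 2" by simp
    then show ?thesis by (simp add: prior_density_def powr_powr del: powr_numeral)
  qed (simp add: prior_density_def)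
  then show ?thesis using nn_integral_norm_powr_inside[where 'a = 'a, of "2 * b"] assms False by simp
qed

lemma nn_integral_improper_prior:
  assumes "g \<in> borel_measurable borel"
  shows "(\<integral>\<^sup>+\<theta>. g \<theta> \<partial>improper_prior a b) = (\<integral>\<^sup>+\<theta>. ennreal (prior_density a b \<theta>) * g \<theta> \<partial>lborel)"
  unfolding improper_prior_def prior_density_def using assms by (subst nn_integral_density) auto

text \<open>The exponent \<open>2 + 2 * e\<close> is the critical one: against a prior that decays like
  \<open>norm \<theta> powr (2 - p)\<close> the integral blows up exactly like \<open>1 / e\<close>.\<close>

lemma prior_integral_decay:
  assumes "DIM('a::euclidean_space) \<ge> 2" "a \<ge> 0" "b > 0" "real DIM('a) / 2 - 1 \<le> b"
    and fin: "a > 0 \<or> (a = 0 \<and> 2 * b < real DIM('a))"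
  obtains C where "C \<ge> 0" "\<And>e. 0 < e \<Longrightarrow> e \<le> 1 \<Longrightarrow>
    (\<integral>\<^sup>+\<theta>. ennreal ((1 + norm \<theta>) powr (-2 - 2 * e)) \<partial>(improper_prior a b :: 'a measure)) \<le> ennreal (C / e)"
proof -
  let ?p = "real DIM('a)" and ?V = "unit_ball_vol (real DIM('a))"
  have [measurable]: "cball (0::'a) 1 \<in> sets borel" "ball (0::'a) 1 \<in> sets borel" by simp_all
  define I where "I = (\<integral>\<^sup>+\<theta>. ennreal (prior_density a b \<theta>) * indicator (cball 0 1) \<theta> \<partial>(lborel :: 'a measure))"
  obtain J where J: "J \<ge> 0" "I = ennreal J"
    using prior_unit_ball_finite[OF assms(3) fin] unfolding I_def[symmetric] by (cases I) auto
  show thesis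
  proof
    \<comment> \<open>\<open>J\<close> is the prior mass of the unit ball. The other summand is the
      outside bound at \<open>q = ?p + 2 * e\<close> with its pole \<open>1 / e\<close> taken out;
      \<open>e \<le> 1\<close> bounds \<open>q\<close> by \<open>?p + 2\<close> and \<open>J\<close>
      by \<open>J / e\<close>.\<close>
    show "J + (?p + 2) * ?V / 2 \<ge> 0" using J by simp
    fix e :: real assume e: "0 < e" "e \<le> 1"
    have "(\<integral>\<^sup>+\<theta>. ennreal ((1 + norm \<theta>) powr (-2 - 2 * e)) \<partial>(improper_prior a b :: 'a measure))
      = (\<integral>\<^sup>+\<theta>. ennreal (prior_density a b \<theta>) * ennreal ((1 + norm \<theta>) powr (-2 - 2 * e)) \<partial>(lborel :: 'a measure))"
      by (rule nn_integral_improper_prior) measurable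
    also have "\<dots> \<le> (\<integral>\<^sup>+\<theta>. ennreal (prior_density a b \<theta>) * indicator (cball 0 1) \<theta> +
        ennreal (norm \<theta> powr (- (?p + 2 * e))) * indicator (- ball 0 1) \<theta> \<partial>(lborel :: 'a measure))"
    proof (rule nn_integral_mono)
      fix \<theta> :: 'a
      show "ennreal (prior_density a b \<theta>) * ennreal ((1 + norm \<theta>) powr (-2 - 2 * e))
        \<le> ennreal (prior_density a b \<theta>) * indicator (cball 0 1) \<theta> +
        ennreal (norm \<theta> powr (- (?p + 2 * e))) * indicator (- ball 0 1) \<theta>"
      proof (cases "norm \<theta> < 1")
        case True
        have "(1 + norm \<theta>) powr (-2 - 2 * e) \<le> (1 + norm \<theta>) powr 0"
          using e by (intro powr_mono) auto
        then have "ennreal ((1 + norm \<theta>) powr (-2 - 2 * e)) \<le> 1" by (simp add: add_nonneg_eq_0_iff)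
        then have "ennreal (prior_density a b \<theta>) * ennreal ((1 + norm \<theta>) powr (-2 - 2 * e)) \<le> ennreal (prior_density a b \<theta>) * 1"
          by (intro mult_left_mono) auto
        then show ?thesis using True by simp
      next
        case False
        then have n: "1 \<le> norm \<theta>" by simp
        have "prior_density a b \<theta> * (1 + norm \<theta>) powr (-2 - 2 * e) \<le> norm \<theta> powr (2 - ?p) * norm \<theta> powr (-2 - 2 * e)"
          using n e by (intro mult_mono prior_density_le_outside assms powr_mono2') auto
        also have "\<dots> = norm \<theta> powr (- (?p + 2 * e))" by (simp add: powr_add[symmetric])
        finally show ?thesis using n
          by (auto simp: ennreal_mult'[symmetric] prior_density_nonneg indicator_def intro!: ennreal_leI add_increasing)
      qed
    qed
    also have "\<dots> = ennreal J + (\<integral>\<^sup>+\<theta>. ennreal (norm \<theta> powr (- (?p + 2 * e))) * indicator (- ball 0 1) \<theta> \<partial>(lborel :: 'a measure))"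
      unfolding J(2)[symmetric] I_def by (rule nn_integral_add) measurable
    also have "\<dots> \<le> ennreal J + ennreal ((?p + 2 * e) * ?V / (?p + 2 * e - ?p))"
      using e by (intro add_left_mono nn_integral_norm_powr_outside) auto
    also have "\<dots> = ennreal (J + (?p + 2 * e) * ?V / (2 * e))" using J e by (simp flip: ennreal_plus)
    also have "\<dots> \<le> ennreal ((J + (?p + 2) * ?V / 2) / e)"
    proof (rule ennreal_leI)
      have "J * e \<le> J" using J(1) e by (simp add: mult_left_le)
      then have "J \<le> J / e" using e by (simp add: pos_le_divide_eq)
      moreover have "(?p + 2 * e) * ?V / (2 * e) \<le> (?p + 2) * ?V / (2 * e)"
        using e by (intro divide_right_mono mult_right_mono) auto
      ultimately show "J + (?p + 2 * e) * ?V / (2 * e) \<le> (J + (?p + 2) * ?V / 2) / e"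
        by (simp add: add_divide_distrib[of J])
    qed
    finally show "(\<integral>\<^sup>+\<theta>. ennreal ((1 + norm \<theta>) powr (-2 - 2 * e)) \<partial>(improper_prior a b :: 'a measure))
      \<le> ennreal ((J + (?p + 2) * ?V / 2) / e)" .
  qed
qed

section \<open>Gaussian moments and translation\<close>

text \<open>The Gaussian factor dominates \<open>DIM('a) + 1\<close> further powers of
  \<open>1 + norm z\<close>. The integrand is therefore bounded on the unit ball and decays outside
  like \<open>norm z\<close> to a power one beyond the dimension, which is integrable.\<close>

lemma gauss_moment_finite:
  "(\<integral>\<^sup>+z. ennreal (exp (- (norm z)\<^sup>2 / 2) * (1 + norm z) ^ k) \<partial>(lborel :: 'a::euclidean_space measure)) < \<infinity>"
proof -
  let ?p = "DIM('a)"
  have [measurable]: "cball (0::'a) 1 \<in> sets borel" "ball (0::'a) 1 \<in> sets borel" by simp_all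
  define B :: real where "B = fact (k + ?p + 1) * exp (3 / 2)"
  have B0: "B \<ge> 0" by (simp add: B_def)
  have main: "exp (- s\<^sup>2 / 2) * (1 + s) ^ (k + ?p + 1) \<le> B" if "s \<ge> 0" for s :: real
  proof -
    \<comment> \<open>A single term of the exponential series at \<open>1 + s\<close> bounds the
      power. The exponent \<open>1 + s - s\<^sup>2 / 2\<close> that results has its maximum
      \<open>3 / 2\<close> at \<open>s = 1\<close>.\<close>
    have "(\<Sum>n\<in>{k + ?p + 1}. (1 + s) ^ n /\<^sub>R fact n) \<le> exp (1 + s)"
      unfolding exp_def using that
      by (intro sum_le_suminf summable_exp_generic) auto
    then have "(1 + s) ^ (k + ?p + 1) \<le> fact (k + ?p + 1) * exp (1 + s)"
      by (simp add: field_simps del: power_Suc fact_Suc)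
    then have "exp (- s\<^sup>2 / 2) * (1 + s) ^ (k + ?p + 1) \<le> exp (- s\<^sup>2 / 2) * (fact (k + ?p + 1) * exp (1 + s))"
      by (intro mult_left_mono) auto
    also have "\<dots> = fact (k + ?p + 1) * exp (1 + s - s\<^sup>2 / 2)"
    proof -
      have "exp (1 + s - s\<^sup>2 / 2) = exp (- s\<^sup>2 / 2) * exp (1 + s)" by (simp flip: exp_add)
      then show ?thesis by (simp only: mult_ac)
    qed
    also have "\<dots> \<le> B"
    proof -
      have "1 + s - s\<^sup>2 / 2 \<le> 3 / 2"
        using zero_le_power2[of "s - 1"] by (simp add: power2_eq_square algebra_simps)
      then show ?thesis unfolding B_def by (intro mult_left_mono) auto
    qed
    finally show ?thesis .
  qed
  have "(\<integral>\<^sup>+z. ennreal (exp (- (norm z)\<^sup>2 / 2) * (1 + norm z) ^ k) \<partial>(lborel :: 'a measure))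
    \<le> (\<integral>\<^sup>+z. ennreal B * indicator (cball 0 1) z +
       ennreal B * (ennreal (norm z powr (- (real ?p + 1))) * indicator (- ball 0 1) z) \<partial>(lborel :: 'a measure))"
  proof (rule nn_integral_mono)
    fix z :: 'a
    have le: "exp (- (norm z)\<^sup>2 / 2) * (1 + norm z) ^ k * (1 + norm z) ^ (?p + 1) \<le> B"
      using main[of "norm z"] by (simp add: power_add mult_ac)
    show "ennreal (exp (- (norm z)\<^sup>2 / 2) * (1 + norm z) ^ k) \<le> ennreal B * indicator (cball 0 1) z +
       ennreal B * (ennreal (norm z powr (- (real ?p + 1))) * indicator (- ball 0 1) z)"
    proof (cases "norm z < 1")
      case True
      have "exp (- (norm z)\<^sup>2 / 2) * (1 + norm z) ^ k * 1 \<le> exp (- (norm z)\<^sup>2 / 2) * (1 + norm z) ^ k * (1 + norm z) ^ (?p + 1)"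
        by (intro mult_left_mono one_le_power) auto
      then have "exp (- (norm z)\<^sup>2 / 2) * (1 + norm z) ^ k \<le> B" using le by linarith
      then show ?thesis using True by (simp add: ennreal_leI)
    next
      case False
      then have n: "norm z \<ge> 1" by simp
      have "exp (- (norm z)\<^sup>2 / 2) * (1 + norm z) ^ k * norm z ^ (?p + 1) \<le> exp (- (norm z)\<^sup>2 / 2) * (1 + norm z) ^ k * (1 + norm z) ^ (?p + 1)"
        by (intro mult_left_mono power_mono) auto
      note prod_le = order_trans[OF this le]
      have "exp (- (norm z)\<^sup>2 / 2) * (1 + norm z) ^ k \<le> B / norm z ^ (?p + 1)"
      proof -
        have "0 < norm z ^ (?p + 1)" using n by (intro zero_less_power) linarith
        from pos_le_divide_eq[OF this] show ?thesis using prod_le by blast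
      qed
      also have "\<dots> = B * norm z powr (- (real ?p + 1))"
      proof -
        have "norm z powr (real ?p + 1) = norm z ^ (?p + 1)"
          using powr_realpow[of "norm z" "?p + 1"] less_le_trans[OF zero_less_one n] by (simp add: add.commute)
        then show ?thesis using powr_minus_divide[of "norm z" "real ?p + 1"] by simp
      qed
      finally show ?thesis using n B0
        by (auto simp: ennreal_mult[symmetric] indicator_def intro!: ennreal_leI add_increasing)
    qed
  qed
  also have "\<dots> = ennreal B * emeasure lborel (cball 0 1 :: 'a set) + ennreal B * 
     (\<integral>\<^sup>+z. ennreal (norm z powr (- (real ?p + 1))) * indicator (- ball 0 1) z \<partial>(lborel :: 'a measure))"
    by (subst nn_integral_add, measurable, subst nn_integral_cmult, measurable)
       (simp add: nn_integral_cmult_indicator)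
  also have "\<dots> < \<infinity>"
    using nn_integral_norm_powr_outside[where 'a = 'a, of "real ?p + 1"] 
    by (auto simp: emeasure_cball ennreal_mult_less_top intro: le_less_trans)
  finally show ?thesis .
qed

lemma nn_integral_lborel_translate:
  fixes g :: "'a::euclidean_space \<Rightarrow> ennreal"
  assumes "g \<in> borel_measurable borel"
  shows "(\<integral>\<^sup>+x. g (x - c) \<partial>lborel) = (\<integral>\<^sup>+x. g x \<partial>lborel)"
proof -
  have "(\<integral>\<^sup>+x. g x \<partial>lborel) = (\<integral>\<^sup>+x. g x \<partial>distr lborel borel ((+) (- c)))"
    by (simp add: lborel_distr_plus)
  also have "\<dots> = (\<integral>\<^sup>+x. g (x - c) \<partial>lborel)" using assms by (subst nn_integral_distr) auto
  finally show ?thesis by simp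
qed

subsection \<open>The Gaussian model\<close>

abbreviation gauss_density :: "'a::euclidean_space \<Rightarrow> 'a \<Rightarrow> real" where
  "gauss_density x \<theta> \<equiv> (2 * pi) powr (- real DIM('a) / 2) * exp (- (norm (x - \<theta>))\<^sup>2 / 2)"

lemma dominated_model_gauss:
  "dominated_model lborel (improper_prior a b) borel (gauss_model :: 'a::euclidean_space \<Rightarrow> _)
     (\<lambda>x \<theta>. ennreal (gauss_density x \<theta>))"
proof -
  \<comment> \<open>The density is real-valued and so finite at every point, even where it is
    unbounded nearby; sigma-finiteness passes from Lebesgue measure to the prior.\<close>
  interpret prior: sigma_finite_measure "improper_prior a b :: 'a measure"
    unfolding improper_prior_def by (subst sigma_finite_measure.sigma_finite_iff_density_finite[OF sigma_finite_lborel]) auto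
  have [measurable_cong]: "sets (improper_prior a b :: 'a measure) = sets borel" by (simp add: improper_prior_def)
  show ?thesis
    by unfold_locales (auto simp: gauss_model_def)
qed

lemma nn_integral_gauss_model:
  assumes [measurable]: "g \<in> borel_measurable borel"
  shows "(\<integral>\<^sup>+x. g (x - \<theta>) \<partial>gauss_model \<theta>) = (\<integral>\<^sup>+z. ennreal (gauss_density z 0) * g z \<partial>lborel)"
proof -
  have "(\<integral>\<^sup>+x. g (x - \<theta>) \<partial>gauss_model \<theta>) = (\<integral>\<^sup>+x. ennreal (gauss_density (x - \<theta>) 0) * g (x - \<theta>) \<partial>lborel)"
    unfolding gauss_model_def by (subst nn_integral_density) auto
  also have "\<dots> = (\<integral>\<^sup>+z. ennreal (gauss_density z 0) * g z \<partial>lborel)"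
    by (rule nn_integral_lborel_translate) measurable
  finally show ?thesis .
qed

text \<open>The law of \<open>x - \<theta>\<close> is the same for all \<theta>, so one constant
  serves them all. The case \<open>k = 6\<close> enters the energy estimate; \<open>k = 0\<close>
  bounds the total mass.\<close>

lemma gauss_model_moment:
  obtains K where "K \<ge> 0"
    "\<And>\<theta> :: 'a::euclidean_space. (\<integral>\<^sup>+x. ennreal ((1 + norm (x - \<theta>)) ^ k) \<partial>gauss_model \<theta>) = ennreal K"
proof -
  let ?c = "(2 * pi) powr (- real DIM('a) / 2)"
  define I where "I = (\<integral>\<^sup>+z. ennreal (exp (- (norm z)\<^sup>2 / 2) * (1 + norm z) ^ k) \<partial>(lborel :: 'a measure))"
  have "(\<integral>\<^sup>+x. ennreal ((1 + norm (x - \<theta>)) ^ k) \<partial>gauss_model \<theta>) = ennreal (?c * enn2real I)" for \<theta> :: 'a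
  proof -
    have "(\<integral>\<^sup>+x. ennreal ((1 + norm (x - \<theta>)) ^ k) \<partial>gauss_model \<theta>)
       = (\<integral>\<^sup>+z. ennreal ?c * ennreal (exp (- (norm z)\<^sup>2 / 2) * (1 + norm z) ^ k) \<partial>(lborel :: 'a measure))"
      by (subst nn_integral_gauss_model) (auto simp: ennreal_mult mult.assoc)
    also have "\<dots> = ennreal ?c * I" unfolding I_def by (rule nn_integral_cmult) measurable
    also have "\<dots> = ennreal (?c * enn2real I)"
      using gauss_moment_finite[where 'a = 'a, of k] by (simp add: I_def ennreal_mult ennreal_enn2real)
    finally show ?thesis .
  qed
  then show thesis using that[of "?c * enn2real I"] by simp
qed

text \<open>Outside the unit ball the density is at most 1, and Lebesgue measure takes over. Bounded
  test functions with bounded support thus have finite weight.\<close>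

lemma improper_prior_ball_finite:
  assumes "DIM('a::euclidean_space) \<ge> 2" "a \<ge> 0" "b > 0" "real DIM('a) / 2 - 1 \<le> b"
    and "a > 0 \<or> (a = 0 \<and> 2 * b < real DIM('a))"
  shows "emeasure (improper_prior a b) (cball (0::'a) r) < \<infinity>"
proof -
  have [measurable]: "cball (0::'a) s \<in> sets borel" for s by simp
  have "emeasure (improper_prior a b) (cball (0::'a) r) =
     (\<integral>\<^sup>+\<theta>. ennreal (prior_density a b \<theta>) * indicator (cball 0 r) \<theta> \<partial>(lborel :: 'a measure))"
    by (simp add: improper_prior_def prior_density_def emeasure_density)
  also have "\<dots> \<le> (\<integral>\<^sup>+\<theta>. ennreal (prior_density a b \<theta>) * indicator (cball 0 1) \<theta> +
      indicator (cball 0 r) \<theta> \<partial>(lborel :: 'a measure))"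
    using prior_density_le_one[OF assms(1,2,4)]
    by (intro nn_integral_mono) (auto simp: indicator_def add_increasing2)
  also have "\<dots> = (\<integral>\<^sup>+\<theta>. ennreal (prior_density a b \<theta>) * indicator (cball 0 1) \<theta> \<partial>(lborel :: 'a measure)) +
      emeasure lborel (cball (0::'a) r)"
    by (subst nn_integral_add) auto
  also have "\<dots> < \<infinity>"
    using prior_unit_ball_finite[OF assms(3,5)] emeasure_lborel_cball_finite[of "0::'a" r] by simp
  finally show ?thesis .
qed

text \<open>These are the conditions for Bayes' formula at every \<open>x\<close>. For finiteness,
  the Gaussian density is bounded by its constant on the unit ball, while outside the prior density
  is at most 1 and the Gaussian density, symmetric in \<open>x\<close> and \<theta>, integrates over
  \<theta>.\<close>

lemma gauss_marginal_density:
  assumes "DIM('a::euclidean_space) \<ge> 2" "a \<ge> 0" "b > 0" "real DIM('a) / 2 - 1 \<le> b"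
    and "a > 0 \<or> (a = 0 \<and> 2 * b < real DIM('a))"
  shows "(\<integral>\<^sup>+\<theta>. ennreal (gauss_density x \<theta>) \<partial>(improper_prior a b :: 'a measure)) \<noteq> 0"
    and "(\<integral>\<^sup>+\<theta>. ennreal (gauss_density x \<theta>) \<partial>(improper_prior a b :: 'a measure)) \<noteq> \<infinity>"
proof -
  let ?c = "(2 * pi) powr (- real DIM('a) / 2)"
  have [measurable]: "cball (0::'a) s \<in> sets borel" for s by simp
  have eq: "(\<integral>\<^sup>+\<theta>. ennreal (gauss_density x \<theta>) \<partial>(improper_prior a b :: 'a measure)) =
    (\<integral>\<^sup>+\<theta>. ennreal (prior_density a b \<theta>) * ennreal (gauss_density x \<theta>) \<partial>lborel)"
    by (rule nn_integral_improper_prior) measurable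
  show "(\<integral>\<^sup>+\<theta>. ennreal (gauss_density x \<theta>) \<partial>(improper_prior a b :: 'a measure)) \<noteq> 0"
  proof
    assume "(\<integral>\<^sup>+\<theta>. ennreal (gauss_density x \<theta>) \<partial>(improper_prior a b :: 'a measure)) = 0"
    then have "AE \<theta> in lborel. ennreal (prior_density a b \<theta>) * ennreal (gauss_density x \<theta>) = 0"
      unfolding eq by (subst (asm) nn_integral_0_iff_AE) auto
    \<comment> \<open>The origin is set aside because for \<open>a = 0\<close> the density there is
      \<open>0 powr (-b)\<close>, that is 0.\<close>
    moreover have "AE \<theta> in lborel. \<theta> \<noteq> (0::'a)" by (rule AE_lborel_singleton)
    ultimately have zero: "AE \<theta> in lborel. ennreal (prior_density a b \<theta>) * ennreal (gauss_density x \<theta>) = 0 \<and> \<theta> \<noteq> 0"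
      by (rule eventually_conj)
    have "ennreal (prior_density a b \<theta>) * ennreal (gauss_density x \<theta>) \<noteq> 0" if "\<theta> \<noteq> 0" for \<theta> :: 'a
    proof -
      have "a + (norm \<theta>)\<^sup>2 > 0" using that assms(2) by (simp add: add_nonneg_pos)
      then have "prior_density a b \<theta> > 0" by (simp add: prior_density_def)
      then show ?thesis by simp
    qed
    then have "AE \<theta> in (lborel :: 'a measure). False" by (intro eventually_mono[OF zero]) blast
    then show False by (simp add: eventually_False ae_filter_eq_bot_iff)
  qed
  obtain K where K: "\<And>\<theta> :: 'a. (\<integral>\<^sup>+y. ennreal ((1 + norm (y - \<theta>)) ^ 0) \<partial>gauss_model \<theta>) = ennreal K"
    using gauss_model_moment by blast
  have "(\<integral>\<^sup>+\<theta>. ennreal (prior_density a b \<theta>) * ennreal (gauss_density x \<theta>) \<partial>lborel)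
    \<le> (\<integral>\<^sup>+\<theta>. ennreal ?c * (ennreal (prior_density a b \<theta>) * indicator (cball 0 1) \<theta>) +
         ennreal (gauss_density \<theta> x) \<partial>lborel)"
  proof (rule nn_integral_mono)
    fix \<theta> :: 'a
    have sym: "gauss_density x \<theta> = gauss_density \<theta> x" by (simp add: norm_minus_commute)
    show "ennreal (prior_density a b \<theta>) * ennreal (gauss_density x \<theta>) \<le>
      ennreal ?c * (ennreal (prior_density a b \<theta>) * indicator (cball 0 1) \<theta>) + ennreal (gauss_density \<theta> x)"
    proof (cases "norm \<theta> \<le> 1")
      case True
      have "gauss_density x \<theta> \<le> ?c * 1" by (intro mult_left_mono) auto
      then have "ennreal (prior_density a b \<theta>) * ennreal (gauss_density x \<theta>) \<le> ennreal (prior_density a b \<theta>) * ennreal ?c"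
        by (intro mult_left_mono ennreal_leI) auto
      then show ?thesis using True by (simp add: mult.commute add_increasing2)
    next
      case False
      then have "ennreal (prior_density a b \<theta>) \<le> 1"
        using prior_density_le_one[OF assms(1,2,4), of \<theta>] by simp
      from mult_right_mono[OF this, of "ennreal (gauss_density x \<theta>)"] show ?thesis
        using False sym by simp
    qed
  qed
  also have "\<dots> = ennreal ?c * (\<integral>\<^sup>+\<theta>. ennreal (prior_density a b \<theta>) * indicator (cball 0 1) \<theta> \<partial>(lborel :: 'a measure)) +
      (\<integral>\<^sup>+\<theta>. ennreal (gauss_density \<theta> x) \<partial>lborel)"
    by (simp add: nn_integral_add nn_integral_cmult)
  also have "(\<integral>\<^sup>+\<theta>. ennreal (gauss_density \<theta> x) \<partial>lborel) = ennreal K"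
    using K[of x] unfolding gauss_model_def by (subst (asm) nn_integral_density) auto
  also have "ennreal ?c * (\<integral>\<^sup>+\<theta>. ennreal (prior_density a b \<theta>) * indicator (cball 0 1) \<theta> \<partial>(lborel :: 'a measure)) + ennreal K < \<infinity>"
    using prior_unit_ball_finite[OF assms(3,5)] by (simp add: ennreal_mult_less_top)
  finally show "(\<integral>\<^sup>+\<theta>. ennreal (gauss_density x \<theta>) \<partial>(improper_prior a b :: 'a measure)) \<noteq> \<infinity>"
    unfolding eq by simp
qed

subsection \<open>Test functions of small energy\<close>

text \<open>Subtracting \<open>1 / 4\<close> confines the support to a ball. The factor 4 gives
  value at least 1 wherever the power is still at least \<open>1 / 2\<close>, a region that exhausts
  the space as \<open>e\<close> tends to 0.\<close>

definition power_cutoff :: "real \<Rightarrow> 'a::real_normed_vector \<Rightarrow> real" where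
  "power_cutoff e \<theta> = 4 * max 0 ((1 + norm \<theta>) powr (- e) - 1 / 4)"

lemma power_cutoff_measurable [measurable]: "power_cutoff e \<in> borel_measurable borel"
  unfolding power_cutoff_def by measurable

lemma power_cutoff_bounds:
  assumes "e > 0"
  shows "0 \<le> power_cutoff e \<theta>" "power_cutoff e \<theta> \<le> 4"
    and "norm \<theta> > 4 powr (1 / e) \<Longrightarrow> power_cutoff e \<theta> = 0"
    and "e * ln (1 + norm \<theta>) \<le> ln 2 \<Longrightarrow> 1 \<le> power_cutoff e \<theta>"
proof -
  show "0 \<le> power_cutoff e \<theta>" by (simp add: power_cutoff_def)
  have "(1 + norm \<theta>) powr (- e) \<le> (1 + norm \<theta>) powr 0" using assms by (intro powr_mono) auto
  moreover have "1 + norm \<theta> \<noteq> 0" using norm_ge_zero[of \<theta>] by linarith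
  ultimately have "(1 + norm \<theta>) powr (- e) \<le> 1" by simp
  then show "power_cutoff e \<theta> \<le> 4" by (auto simp: power_cutoff_def)
  show "power_cutoff e \<theta> = 0" if "norm \<theta> > 4 powr (1 / e)"
  proof -
    have "(1 + norm \<theta>) powr (- e) \<le> (4 powr (1 / e)) powr (- e)"
      using that assms by (intro powr_mono2') auto
    also have "\<dots> = 1 / 4" using assms by (simp add: powr_powr powr_minus_divide)
    finally show ?thesis by (simp add: power_cutoff_def)
  qed
  show "1 \<le> power_cutoff e \<theta>" if "e * ln (1 + norm \<theta>) \<le> ln 2"
  proof -
    have "exp (- ln 2) \<le> exp (- e * ln (1 + norm \<theta>))" using that by simp
    also have "\<dots> = (1 + norm \<theta>) powr (- e)"
      using \<open>1 + norm \<theta> \<noteq> 0\<close> by (simp add: powr_def)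
    finally have "1 / 2 \<le> (1 + norm \<theta>) powr (- e)" by (simp add: exp_minus)
    then show ?thesis by (simp add: power_cutoff_def)
  qed
qed

text \<open>Taking positive parts is a contraction, so the increment of the power governs that of
  the cutoff. Squaring doubles the decay \<open>-1 - e\<close> to the critical exponent and the
  cubic in \<open>1 + norm (x - \<theta>)\<close> to degree 6.\<close>

lemma power_cutoff_increment:
  assumes "0 < e" "e \<le> 1"
  shows "(power_cutoff e \<theta> - power_cutoff e x)\<^sup>2
    \<le> 16 * e\<^sup>2 * (1 + norm \<theta>) powr (-2 - 2 * e) * (1 + norm (x - \<theta>)) ^ 6"
proof -
  let ?z = "norm (x - \<theta>)"
  let ?d = "\<bar>(1 + norm \<theta>) powr (- e) - (1 + norm x) powr (- e)\<bar>"
  have abs_trans: "A \<le> \<bar>4 * T\<bar>" if "A \<le> \<bar>4 * \<bar>d\<bar>\<bar>" "\<bar>d\<bar> \<le> T" for A d T :: real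
    using that by linarith
  have "\<bar>max 0 (s - 1 / 4) - max 0 (t - 1 / 4)\<bar> \<le> \<bar>s - t\<bar>" for s t :: real by (simp add: max_def abs_if)
  then have "\<bar>power_cutoff e \<theta> - power_cutoff e x\<bar> \<le> \<bar>4 * ?d\<bar>"
    unfolding power_cutoff_def right_diff_distrib[symmetric] abs_mult by simp
  moreover have "?d \<le> e * (1 + ?z) ^ 3 * (1 + norm \<theta>) powr (-1 - e)"
  proof -
    have "?d \<le> e * ?z * (1 + ?z)\<^sup>2 * (1 + norm \<theta>) powr (-1 - e)"
      by (rule powr_neg_increment) (use assms norm_triangle_ineq3[of x \<theta>] in \<open>auto simp: abs_minus_commute\<close>)
    also have "\<dots> \<le> e * (1 + ?z) * (1 + ?z)\<^sup>2 * (1 + norm \<theta>) powr (-1 - e)"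
      using assms by (intro mult_right_mono mult_left_mono) auto
    finally show ?thesis by (simp add: power3_eq_cube power2_eq_square mult.assoc)
  qed
  ultimately have "\<bar>power_cutoff e \<theta> - power_cutoff e x\<bar> \<le> \<bar>4 * (e * (1 + ?z) ^ 3 * (1 + norm \<theta>) powr (-1 - e))\<bar>"
    by (rule abs_trans)
  then have "(power_cutoff e \<theta> - power_cutoff e x)\<^sup>2 \<le> (4 * (e * (1 + ?z) ^ 3 * (1 + norm \<theta>) powr (-1 - e)))\<^sup>2"
    by (simp only: abs_le_square_iff)
  also have "\<dots> = 16 * e\<^sup>2 * ((1 + norm \<theta>) powr (-1 - e))\<^sup>2 * (1 + ?z) ^ 6"
    by (simp add: power_mult_distrib flip: power_mult)
  also have "((1 + norm \<theta>) powr (-1 - e))\<^sup>2 = (1 + norm \<theta>) powr (-2 - 2 * e)"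
    by (simp add: power2_eq_square flip: powr_add)
  finally show ?thesis .
qed

text \<open>The squared increment carries \<open>e\<^sup>2\<close>, its moment in \<open>x\<close>
  does not depend on \<theta>, and the integral that remains costs only \<open>1 / e\<close>. One
  factor \<open>e\<close> survives, so the energy tends to 0 with \<open>e\<close>.\<close>

lemma power_cutoff_energy:
  assumes "DIM('a::euclidean_space) \<ge> 2" "a \<ge> 0" "b > 0" "real DIM('a) / 2 - 1 \<le> b"
    and "a > 0 \<or> (a = 0 \<and> 2 * b < real DIM('a))"
  obtains C where "C \<ge> 0" "\<And>e. 0 < e \<Longrightarrow> e \<le> 1 \<Longrightarrow>
    (\<integral>\<^sup>+\<theta>. (\<integral>\<^sup>+x. ennreal ((power_cutoff e \<theta> - power_cutoff e x)\<^sup>2) \<partial>gauss_model \<theta>) \<partial>(improper_prior a b :: 'a measure))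
     \<le> ennreal (C * e)"
proof -
  obtain C where C: "C \<ge> 0" "\<And>e. 0 < e \<Longrightarrow> e \<le> 1 \<Longrightarrow>
    (\<integral>\<^sup>+\<theta>. ennreal ((1 + norm \<theta>) powr (-2 - 2 * e)) \<partial>(improper_prior a b :: 'a measure)) \<le> ennreal (C / e)"
    using prior_integral_decay[OF assms] by blast
  obtain K where K: "K \<ge> 0" "\<And>\<theta> :: 'a. (\<integral>\<^sup>+x. ennreal ((1 + norm (x - \<theta>)) ^ 6) \<partial>gauss_model \<theta>) = ennreal K"
    using gauss_model_moment by blast
  show thesis
  proof
    show "16 * K * C \<ge> 0" using C(1) K(1) by simp
    fix e :: real assume e: "0 < e" "e \<le> 1"
    have "(\<integral>\<^sup>+\<theta>. (\<integral>\<^sup>+x. ennreal ((power_cutoff e \<theta> - power_cutoff e x)\<^sup>2) \<partial>gauss_model \<theta>) \<partial>(improper_prior a b :: 'a measure))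
      \<le> (\<integral>\<^sup>+\<theta>. ennreal (16 * e\<^sup>2 * K) * ennreal ((1 + norm \<theta>) powr (-2 - 2 * e)) \<partial>(improper_prior a b :: 'a measure))"
    proof (rule nn_integral_mono)
      fix \<theta> :: 'a
      have "(\<integral>\<^sup>+x. ennreal ((power_cutoff e \<theta> - power_cutoff e x)\<^sup>2) \<partial>gauss_model \<theta>)
        \<le> (\<integral>\<^sup>+x. ennreal (16 * e\<^sup>2 * (1 + norm \<theta>) powr (-2 - 2 * e)) * ennreal ((1 + norm (x - \<theta>)) ^ 6) \<partial>gauss_model \<theta>)"
        using power_cutoff_increment[OF e, of \<theta>]
        by (intro nn_integral_mono) (simp add: ennreal_leI flip: ennreal_mult)
      also have "\<dots> = ennreal (16 * e\<^sup>2 * (1 + norm \<theta>) powr (-2 - 2 * e)) * ennreal K"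
        unfolding K(2)[of \<theta>, symmetric] by (rule nn_integral_cmult) (simp add: gauss_model_def)
      also have "\<dots> = ennreal (16 * e\<^sup>2 * K) * ennreal ((1 + norm \<theta>) powr (-2 - 2 * e))"
        using K(1) by (simp add: mult_ac flip: ennreal_mult)
      finally show "(\<integral>\<^sup>+x. ennreal ((power_cutoff e \<theta> - power_cutoff e x)\<^sup>2) \<partial>gauss_model \<theta>) \<le> \<dots>" .
    qed
    also have "\<dots> = ennreal (16 * e\<^sup>2 * K) * (\<integral>\<^sup>+\<theta>. ennreal ((1 + norm \<theta>) powr (-2 - 2 * e)) \<partial>(improper_prior a b :: 'a measure))"
      by (rule nn_integral_cmult) (simp add: improper_prior_def)
    also have "\<dots> \<le> ennreal (16 * e\<^sup>2 * K) * ennreal (C / e)"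
      using C(2)[OF e] by (rule mult_left_mono) simp
    also have "\<dots> = ennreal (16 * K * C * e)"
      using e C(1) K(1) by (simp add: power2_eq_square flip: ennreal_mult)
    finally show "(\<integral>\<^sup>+\<theta>. (\<integral>\<^sup>+x. ennreal ((power_cutoff e \<theta> - power_cutoff e x)\<^sup>2) \<partial>gauss_model \<theta>) \<partial>(improper_prior a b :: 'a measure))
     \<le> ennreal (16 * K * C * e)" .
  qed
qed

section \<open>Choice of the test functions and conclusion\<close>

theorem theorem5p1:
  fixes a b :: real
  assumes "DIM('a::euclidean_space) \<ge> 3"
    and "b > 0" and "a \<ge> 0"
    and "(a > 0 \<and> real DIM('a) / 2 - 1 \<le> b \<and> b \<le> real DIM('a) / 2) \<or>
         (a = 0 \<and> real DIM('a) / 2 - 1 \<le> b \<and> b < real DIM('a) / 2)"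
  shows "strongly_admissible (borel :: 'a measure) (gauss_model :: 'a \<Rightarrow> 'a measure)
           (improper_prior a b)"
proof -
  \<comment> \<open>Cases (A) and (B) are merged into a condition at infinity, the lower bound on
    \<open>b\<close>, and one at the origin, the final disjunction.\<close>
  have ab: "DIM('a) \<ge> 2" "a \<ge> 0" "b > 0" "real DIM('a) / 2 - 1 \<le> b" "a > 0 \<or> (a = 0 \<and> 2 * b < real DIM('a))"
    using assms by auto
  interpret dominated_model lborel "improper_prior a b :: 'a measure" borel gauss_model
    "\<lambda>x \<theta>. ennreal (gauss_density x \<theta>)" by (rule dominated_model_gauss)
  obtain K where K: "\<And>\<theta> :: 'a. (\<integral>\<^sup>+x. ennreal ((1 + norm (x - \<theta>)) ^ 0) \<partial>gauss_model \<theta>) = ennreal K"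
    using gauss_model_moment by blast
  obtain C where C: "C \<ge> 0" "\<And>e. 0 < e \<Longrightarrow> e \<le> 1 \<Longrightarrow>
    (\<integral>\<^sup>+\<theta>. (\<integral>\<^sup>+x. ennreal ((power_cutoff e \<theta> - power_cutoff e x)\<^sup>2) \<partial>gauss_model \<theta>) \<partial>(improper_prior a b :: 'a measure))
     \<le> ennreal (C * e)"
    using power_cutoff_energy[OF ab] by blast
  show ?thesis unfolding strongly_admissible_def
  proof (intro conjI allI impI ballI)
    show "\<exists>Q. formal_posterior borel gauss_model (improper_prior a b :: 'a measure) Q"
      using formal_posterior_exists gauss_marginal_density[OF ab] by blast
  next
    fix Q and \<phi> :: "'a \<Rightarrow> real"
    assume Q: "formal_posterior borel gauss_model (improper_prior a b :: 'a measure) Q"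
      and \<phi>: "\<phi> \<in> borel_measurable (improper_prior a b)" "bounded (\<phi> ` space (improper_prior a b))"
    show "almost_admissible borel gauss_model (improper_prior a b) \<phi> (\<lambda>x. \<integral>\<theta>. \<phi> \<theta> \<partial>Q x)"
    proof (rule almost_admissible_blyth[OF Q \<phi>, where B = K and C = "\<lambda>n. cball 0 (real n)"])
      show "emeasure (gauss_model \<theta>) (space lborel) \<le> ennreal K" for \<theta> :: 'a
        using K[of \<theta>] by (simp add: gauss_model_def)
      show "cball 0 (real n) \<in> sets (improper_prior a b :: 'a measure)" for n by (simp add: improper_prior_def)
      show "space (improper_prior a b :: 'a measure) \<subseteq> (\<Union>n. cball 0 (real n))"
        by (auto simp: real_arch_simple)
      fix n and \<delta> :: real assume \<delta>: "\<delta> > 0"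
      \<comment> \<open>The second bound makes the energy at most \<open>\<delta>\<close>; the third
        keeps the cutoff at least 1 on the ball of radius \<open>n\<close>. The added ones keep the
        denominators positive when \<open>C = 0\<close> or \<open>n = 0\<close>.\<close>
      define e where "e = min 1 (min (\<delta> / (C + 1)) (ln 2 / (1 + ln (1 + real n))))"
      have e: "0 < e" "e \<le> 1" "e \<le> \<delta> / (C + 1)" "e \<le> ln 2 / (1 + ln (1 + real n))"
        using \<delta> C(1) by (auto simp: e_def add_pos_nonneg)
      have "C * e \<le> \<delta>"
      proof -
        have "e * (C + 1) \<le> \<delta>" using e(3) C(1) by (simp add: pos_le_divide_eq)
        then show ?thesis using e(1) by (simp add: algebra_simps)
      qed
      then have energy: "(\<integral>\<^sup>+\<theta>. (\<integral>\<^sup>+x. ennreal ((power_cutoff e \<theta> - power_cutoff e x)\<^sup>2) \<partial>gauss_model \<theta>) \<partial>(improper_prior a b :: 'a measure))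
         \<le> ennreal \<delta>"
        using C(2)[OF e(1,2)] by (meson ennreal_leI order_trans)
      have large: "1 \<le> \<bar>power_cutoff e \<theta>\<bar>" if "\<theta> \<in> cball 0 (real n)" for \<theta> :: 'a
      proof -
        have "e * ln (1 + norm \<theta>) \<le> e * (1 + ln (1 + real n))"
          using e(1) that by (intro mult_left_mono add_increasing) (auto simp: add_pos_nonneg)
        also have "\<dots> \<le> ln 2" using e(4) by (simp add: pos_le_divide_eq add_pos_nonneg)
        finally show ?thesis using power_cutoff_bounds(4)[OF e(1), of \<theta>] by simp
      qed
      have "(\<integral>\<^sup>+\<theta>. ennreal ((power_cutoff e \<theta>)\<^sup>2) \<partial>(improper_prior a b :: 'a measure))
        \<le> (\<integral>\<^sup>+\<theta>. ennreal 16 * indicator (cball 0 (4 powr (1 / e))) \<theta> \<partial>(improper_prior a b :: 'a measure))"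
      proof (rule nn_integral_mono)
        fix \<theta> :: 'a
        have "(power_cutoff e \<theta>)\<^sup>2 \<le> 4\<^sup>2"
          using power_cutoff_bounds(1,2)[OF e(1), of \<theta>] by (intro power_mono) auto
        then show "ennreal ((power_cutoff e \<theta>)\<^sup>2) \<le> ennreal 16 * indicator (cball 0 (4 powr (1 / e))) \<theta>"
          using power_cutoff_bounds(3)[OF e(1), of \<theta>]
          by (cases "norm \<theta> > 4 powr (1 / e)") (auto simp: indicator_def ennreal_leI simp del: ennreal_numeral)
      qed
      also have "\<dots> = ennreal 16 * emeasure (improper_prior a b) (cball (0::'a) (4 powr (1 / e)))"
        by (rule nn_integral_cmult_indicator) (simp add: improper_prior_def)
      also have "\<dots> < \<infinity>"
        using improper_prior_ball_finite[OF ab, of "4 powr (1 / e)"] by (simp add: ennreal_mult_less_top)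
      finally have fin: "(\<integral>\<^sup>+\<theta>. ennreal ((power_cutoff e \<theta>)\<^sup>2) \<partial>(improper_prior a b :: 'a measure)) < \<infinity>" .
      have bd: "\<bar>power_cutoff e \<theta>\<bar> \<le> 4" for \<theta> :: 'a using power_cutoff_bounds(1,2)[OF e(1), of \<theta>] by simp
      \<comment> \<open>The same function serves as \<open>u\<close> on the parameter and as
        \<open>v\<close> on the observation; the centre is thus \<open>u\<close> evaluated at
        \<open>x\<close>.\<close>
      show "\<exists>u v L. u \<in> borel_measurable (improper_prior a b) \<and> v \<in> borel_measurable borel \<and>
        (\<forall>\<theta>\<in>space (improper_prior a b). \<bar>u \<theta>\<bar> \<le> L) \<and> (\<forall>\<theta>\<in>cball 0 (real n). 1 \<le> \<bar>u \<theta>\<bar>) \<and>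
        (\<integral>\<^sup>+\<theta>. ennreal ((u \<theta>)\<^sup>2) \<partial>improper_prior a b) < \<infinity> \<and>
        (\<integral>\<^sup>+\<theta>. (\<integral>\<^sup>+x. ennreal ((u \<theta> - v x)\<^sup>2) \<partial>(gauss_model \<theta> :: 'a measure)) \<partial>improper_prior a b) \<le> ennreal \<delta>"
        using bd large fin energy
        by (intro exI[of _ "power_cutoff e"] exI[of _ 4] conjI ballI)
          (simp_all add: improper_prior_def power_cutoff_measurable)
    qed
  qed
qed

end
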